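(* Let $N\ge 1$ be an integer and let $\langle Z_\alpha\rangle$ be a net of nonempty finite multisets in $\mathbf{P}^N_K$. If the reduction $\langle\tilde Z_\alpha\rangle$ is weakly generic in $\mathbb{P}^N_{\tilde K}$, then $\langle Z_\alpha\rangle$ is $\delta_\gamma$-equidistributed.
   Context: $K$ is a field complete with respect to a nontrivial non-archimedean absolute value $|\cdot|$, with valuation ring $K^\circ=\{a:|a|\le 1\}$, maximal ideal $K^{\circ\circ}=\{a:|a|<1\}$ and residue field $\tilde K=K^\circ/K^{\circ\circ}$; $\mathbb{K}$ is the completion of an algebraic closure of $K$ with respect to the unique extension of $|\cdot|$. $K[X]=K[X_0,\dots,X_N]$, and similarly for $K^\circ[X]$, $\tilde K[X]$. Berkovich affine space: $\mathbf{A}^{N+1}_K$ is the set of multiplicative seminorms on $K[X]$ extending $|\cdot|$, i.e. functions $[\cdot]:K[X]\to[0,\infty)$ with $[a]=|a|$ for $a\in K$, $[f+g]\le\max\{[f],[g]\}$ and $[fg]=[f][g]$. The seminorm corresponding to a point $\zeta$ is written $[\cdot]_\zeta$. The topology is the weakest one making $\zeta\mapsto[f]_\zeta$ continuous for every $f\in K[X]$. The point $0$ is the seminorm $f\mapsto|f(0)|$. Put $\|\zeta\|=\max\{[X_0]_\zeta,\dots,[X_N]_\zeta\}$. Berkovich projective space: $\mathbf{P}^N_K$ is the quotient of $\mathbf{A}^{N+1}_K\setminus\{0\}$, with the quotient topology, by the equivalence relation: $\zeta\sim\xi$ iff there is a constant $\lambda>0$ with $[f]_\zeta=\lambda^{\deg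 f}[f]_\xi$ for all homogeneous $f\in K[X]$. Let $\pi$ be the quotient map. Every $z\in\mathbf{P}^N_K$ equals $\pi(\zeta)$ for some $\zeta$ with $\|\zeta\|=1$. Reduction map $r:\mathbf{P}^N_K\to\mathbb{P}^N_{\tilde K}=\mathrm{Proj}(\tilde K[X])$: given $z\in\mathbf{P}^N_K$, choose $\zeta$ with $\pi(\zeta)=z$ and $\|\zeta\|=1$. Let $\wp_\zeta=\{f\in K^\circ[X]:[f]_\zeta<1\}$, a prime ideal of $K^\circ[X]$, and let $\tilde\wp_\zeta$ be its image in $\tilde K[X]$ under coefficientwise reduction, a prime ideal of $\tilde K[X]$. Then $r(z)=\pi_{\mathrm{sch}}(\tilde\wp_\zeta)$, where $\pi_{\mathrm{sch}}:\mathbb{A}^{N+1}_{\tilde K}\setminus\{\mathfrak{p}_0\}\to\mathbb{P}^N_{\tilde K}$ is the standard projection ($\mathbb{A}^{N+1}_{\tilde K}=\mathrm{Spec}(\tilde K[X])$, $\mathfrak{p}_0$ the ideal of polynomials vanishing at the origin), sending a prime ideal $\mathfrak{p}$ to the homogeneous prime ideal generated by the homogeneous elements of $\mathfrak{p}$. This is independent of the choice of $\zeta$. For a finite multiset $Z$ in $\mathbf{P}^N_K$ (a set whose points occur with multiplicities), its reduction $\tilde Z$ is the finite multiset in $\mathbb{P}^N_{\tilde K}$ in which the multiplicity of a point $\tilde z$ is the sum of the multiplicities in $Z$ of the points of $r^{-1}(\tilde z)$; thus $|\tilde Z|=|Z|$. A net $\langle\tilde Z_\alpha\rangle$ of nonempty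 finite multisets in $\mathbb{P}^N_{\tilde K}$ is weakly generic if $\lim_\alpha|\tilde Z_\alpha\cap W|/|\tilde Z_\alpha|=0$ for every proper Zariski-closed subset $W\subset\mathbb{P}^N_{\tilde K}$ (cardinalities counted with multiplicity). Gauss point: $\zeta_{0,1}\in\mathbf{A}^{N+1}_K$ is given by $[f]_{\zeta_{0,1}}=\sup\{|f(b)|: b\in\mathbb{K}^{N+1},\ |b_n|\le 1\text{ for all }0\le n\le N\}$; $\gamma=\pi(\zeta_{0,1})$, and $\delta_\gamma$ is the unit Dirac measure at $\gamma$. Equidistribution: for a unit Borel measure $\mu$ on $\mathbf{P}^N_K$, a net $\langle Z_\alpha\rangle$ of nonempty finite multisets in $\mathbf{P}^N_K$ is $\mu$-equidistributed if $\frac{1}{|Z_\alpha|}\sum_{z\in Z_\alpha}\varphi(z)\to\int\varphi\,d\mu$ for every continuous $\varphi:\mathbf{P}^N_K\to\mathbb{R}$ (counted with multiplicity). *)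

theory Defs
  imports
    "HOL-Library.Poly_Mapping"
    "HOL-Library.Multiset"
    "HOL-Algebra.Algebraic_Closure_Type"
    "HOL-Probability.Giry_Monad"
begin

section \<open>Complete non-archimedean fields and their residue fields\<close>

text \<open>The absolute value has its own name because \<^const>\<open>norm\<close> is reserved for real normed
  vector spaces. Completeness refers to the metric induced by it.\<close>

class complete_nonarch_field = field + complete_space +
  fixes nabs :: "'a \<Rightarrow> real"
  assumes dist_nabs: "dist x y = nabs (x - y)"
    and nabs_mult: "nabs (x * y) = nabs x * nabs y"
    and nabs_add_max: "nabs (x + y) \<le> max (nabs x) (nabs y)"
    and nabs_nontrivial: "\<exists>x. x \<noteq> 0 \<and> nabs x \<noteq> 1"

lemma nabs_zero [simp]: "nabs 0 = 0"
  using dist_nabs[of 0 0] by simp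

lemma nabs_eq_0 [simp]: "nabs x = 0 \<longleftrightarrow> x = 0"
  using dist_nabs[of x 0] dist_eq_0_iff[of x 0] by (simp del: dist_eq_0_iff)

lemma nabs_nonneg [simp]: "nabs x \<ge> 0"
  using dist_nabs[of x 0] zero_le_dist[of x 0] by simp

lemma nabs_one [simp]: "nabs 1 = 1"
  using nabs_mult[of 1 1] nabs_eq_0[of 1] by simp

lemma nabs_minus [simp]: "nabs (- x) = nabs x"
  using dist_nabs[of 0 x] dist_nabs[of x 0] by (simp add: dist_commute)

lemma nabs_diff_max: "nabs (x - y) \<le> max (nabs x) (nabs y)"
  using nabs_add_max[of x "- y"] by simp

lemma nabs_inverse: "nabs (inverse x) = inverse (nabs x)"
proof (cases "x = 0")
  case False
  then have "nabs x * nabs (inverse x) = 1"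
    by (simp flip: nabs_mult)
  then show ?thesis
    by (rule inverse_unique[symmetric])
qed simp

lemma nabs_add_le: "nabs x \<le> c \<Longrightarrow> nabs y \<le> c \<Longrightarrow> nabs (x + y) \<le> c"
  using nabs_add_max[of x y] by simp

lemma nabs_add_less: "nabs x < c \<Longrightarrow> nabs y < c \<Longrightarrow> nabs (x + y) < c"
  using nabs_add_max[of x y] by simp

lemma nabs_diff_le: "nabs x \<le> c \<Longrightarrow> nabs y \<le> c \<Longrightarrow> nabs (x - y) \<le> c"
  using nabs_diff_max[of x y] by simp

lemma nabs_diff_less: "nabs x < c \<Longrightarrow> nabs y < c \<Longrightarrow> nabs (x - y) < c"
  using nabs_diff_max[of x y] by simp

definition residue_rel :: "'a::complete_nonarch_field \<Rightarrow> 'a \<Rightarrow> bool" where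
  "residue_rel x y \<longleftrightarrow> nabs x \<le> 1 \<and> nabs y \<le> 1 \<and> nabs (x - y) < 1"

lemma part_equivp_residue_rel: "part_equivp residue_rel"
proof (rule part_equivpI)
  show "\<exists>x. residue_rel x x"
    by (rule exI[of _ 0]) (simp add: residue_rel_def)
  show "symp residue_rel"
    by (rule sympI) (auto simp: residue_rel_def simp flip: dist_nabs simp: dist_commute)
  show "transp residue_rel"
  proof (rule transpI)
    fix x y z assume "residue_rel x y" "residue_rel y z"
    then show "residue_rel x z"
      using nabs_add_less[of "x - y" 1 "y - z"] by (simp add: residue_rel_def)
  qed
qed

lemma residue_rel_eq_norm:
  assumes "residue_rel x y"
  shows "nabs x < 1 \<longleftrightarrow> nabs y < 1"
  using assms nabs_add_less[of "x - y" 1 y] nabs_diff_less[of x 1 "x - y"]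
  by (auto simp: residue_rel_def)

quotient_type (overloaded) 'a residue_field =
    "'a::complete_nonarch_field" / partial: residue_rel
  by (rule part_equivp_residue_rel)

text \<open>The canonical map from the valuation ring onto the residue field; its value is
  meaningful only on elements of absolute value at most 1.\<close>

definition residue :: "'a::complete_nonarch_field \<Rightarrow> 'a residue_field" where
  "residue = abs_residue_field"

instantiation residue_field :: (complete_nonarch_field) "field"
begin

lift_definition zero_residue_field :: "'a residue_field" is 0
  by (simp add: residue_rel_def)

lift_definition one_residue_field :: "'a residue_field" is 1
  by (simp add: residue_rel_def)

lift_definition plus_residue_field :: "'a residue_field \<Rightarrow> 'a residue_field \<Rightarrow> 'a residue_field"
  is "(+)"
proof -
  fix a b c d :: 'a
  assume *: "residue_rel a b" "residue_rel c d"
  have eq: "(a + c) - (b + d) = (a - b) + (c - d)" by simp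
  have "nabs ((a + c) - (b + d)) < 1"
    unfolding eq by (rule nabs_add_less) (use * in \<open>auto simp: residue_rel_def\<close>)
  with * show "residue_rel (a + c) (b + d)"
    by (simp add: residue_rel_def nabs_add_le)
qed

lift_definition uminus_residue_field :: "'a residue_field \<Rightarrow> 'a residue_field"
  is uminus
proof -
  fix a b :: 'a
  assume "residue_rel a b"
  then show "residue_rel (- a) (- b)"
    using nabs_minus[of "a - b"] by (simp add: residue_rel_def)
qed

lift_definition minus_residue_field :: "'a residue_field \<Rightarrow> 'a residue_field \<Rightarrow> 'a residue_field"
  is "(-)"
proof -
  fix a b c d :: 'a
  assume *: "residue_rel a b" "residue_rel c d"
  have eq: "(a - c) - (b - d) = (a - b) - (c - d)" by simp
  have "nabs ((a - c) - (b - d)) < 1"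
    unfolding eq by (rule nabs_diff_less) (use * in \<open>auto simp: residue_rel_def\<close>)
  with * show "residue_rel (a - c) (b - d)"
    by (simp add: residue_rel_def nabs_diff_le)
qed

lift_definition times_residue_field :: "'a residue_field \<Rightarrow> 'a residue_field \<Rightarrow> 'a residue_field"
  is "(*)"
proof -
  fix a b c d :: 'a
  assume *: "residue_rel a b" "residue_rel c d"
  have le: "nabs (a * c) \<le> 1" "nabs (b * d) \<le> 1"
    using * by (auto simp: residue_rel_def nabs_mult mult_le_one)
  have "nabs ((a - b) * c) < 1" "nabs (b * (c - d)) < 1"
    using * mult_le_less_imp_less[of "nabs c" 1 "nabs (a - b)" 1]
      mult_mono[of "nabs (a - b)" "nabs (a - b)" "nabs c" 1]
      mult_mono[of "nabs b" 1 "nabs (c - d)" "nabs (c - d)"]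
    by (auto simp: residue_rel_def nabs_mult)
  then have "nabs ((a - b) * c + b * (c - d)) < 1"
    by (rule nabs_add_less)
  moreover have "a * c - b * d = (a - b) * c + b * (c - d)"
    by (simp add: algebra_simps)
  ultimately show "residue_rel (a * c) (b * d)"
    using le by (simp add: residue_rel_def)
qed

text \<open>Representatives of absolute value less than 1 represent zero, whose inverse is zero by
  convention; all other representatives are units of the valuation ring.\<close>

lift_definition inverse_residue_field :: "'a residue_field \<Rightarrow> 'a residue_field"
  is "\<lambda>x. if nabs x < 1 then 0 else inverse x"
proof -
  fix a b :: 'a
  assume ab: "residue_rel a b"
  show "residue_rel (if nabs a < 1 then 0 else inverse a) (if nabs b < 1 then 0 else inverse b)"
  proof (cases "nabs a < 1")
    case True
    then show ?thesis using residue_rel_eq_norm[OF ab] by (simp add: residue_rel_def)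
  next
    case False
    then have n: "nabs a = 1" "nabs b = 1"
      using ab residue_rel_eq_norm[OF ab] by (auto simp: residue_rel_def)
    then have nz: "a \<noteq> 0" "b \<noteq> 0" by auto
    have "inverse a - inverse b = - (inverse a * (a - b) * inverse b)"
      using nz by (simp add: inverse_diff_inverse)
    then have "nabs (inverse a - inverse b) = nabs (a - b)"
      using n by (simp add: nabs_mult nabs_inverse)
    then show ?thesis
      using n ab by (simp add: residue_rel_def nabs_inverse)
  qed
qed

definition divide_residue_field :: "'a residue_field \<Rightarrow> 'a residue_field \<Rightarrow> 'a residue_field"
  where "divide_residue_field x y = x * inverse y"

instance
proof
  fix a b c :: "'a residue_field"
  show "a + b + c = a + (b + c)"
    by transfer (simp add: residue_rel_def nabs_add_le add.assoc)
  show "a + b = b + a"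
    by transfer (simp add: residue_rel_def nabs_add_le add.commute)
  show "0 + a = a"
    by transfer (simp add: residue_rel_def)
  show "- a + a = 0"
    by transfer (simp add: residue_rel_def)
  show "a - b = a + - b"
    by transfer (simp add: residue_rel_def nabs_diff_le)
  show "a * b * c = a * (b * c)"
    by transfer (simp add: residue_rel_def nabs_mult mult_le_one mult.assoc)
  show "a * b = b * a"
    by transfer (simp add: residue_rel_def nabs_mult mult_le_one mult.commute)
  show "1 * a = a"
    by transfer (simp add: residue_rel_def)
  show "(a + b) * c = a * c + b * c"
    by transfer (simp add: residue_rel_def nabs_mult mult_le_one nabs_add_le algebra_simps)
  show "(0::'a residue_field) \<noteq> 1"
    by transfer (simp add: residue_rel_def)
  show "inverse (0::'a residue_field) = 0"
    by transfer (simp add: residue_rel_def)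
  show "a \<noteq> 0 \<Longrightarrow> inverse a * a = 1"
  proof transfer
    fix x :: 'a
    assume x: "residue_rel x x" "\<not> residue_rel x 0"
    then have "\<not> nabs x < 1" "x \<noteq> 0" by (auto simp: residue_rel_def)
    then show "residue_rel ((if nabs x < 1 then 0 else inverse x) * x) 1"
      by (simp add: residue_rel_def)
  qed
  show "a div b = a * inverse b"
    by (rule divide_residue_field_def)
qed

end

section \<open>Polynomials\<close>

text \<open>Polynomials in indeterminates indexed by a finite type \<^typ>\<open>'n\<close>: finitely supported
  functions from exponent vectors to coefficients, with the convolution product.\<close>

type_synonym ('n, 'a) mpol = "('n \<Rightarrow>\<^sub>0 nat) \<Rightarrow>\<^sub>0 'a"

definition mpol_const :: "'a::zero \<Rightarrow> ('n, 'a) mpol" where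
  "mpol_const a = Poly_Mapping.single 0 a"

definition mpol_var :: "'n \<Rightarrow> ('n, 'a::zero_neq_one) mpol" where
  "mpol_var i = Poly_Mapping.single (Poly_Mapping.single i 1) 1"

definition homogeneous_mpol :: "nat \<Rightarrow> ('n::finite, 'a::zero) mpol \<Rightarrow> bool" where
  "homogeneous_mpol d f \<longleftrightarrow>
     (\<forall>m\<in>Poly_Mapping.keys f. (\<Sum>i\<in>UNIV. Poly_Mapping.lookup m i) = d)"

text \<open>Evaluation at \<open>b\<close> after mapping the coefficients through \<open>h\<close>.\<close>

definition eval_mpol ::
    "('a::zero \<Rightarrow> 'b) \<Rightarrow> ('n::finite \<Rightarrow> 'b) \<Rightarrow> ('n, 'a) mpol \<Rightarrow> 'b::comm_semiring_1" where
  "eval_mpol h b f = (\<Sum>m\<in>Poly_Mapping.keys f.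
     h (Poly_Mapping.lookup f m) * (\<Prod>i\<in>UNIV. b i ^ Poly_Mapping.lookup m i))"

lemma eval_mpol_superset:
  assumes "h 0 = 0" "finite S" "Poly_Mapping.keys f \<subseteq> S"
  shows "eval_mpol h b f =
    (\<Sum>m\<in>S. h (Poly_Mapping.lookup f m) * (\<Prod>i\<in>UNIV. b i ^ Poly_Mapping.lookup m i))"
  unfolding eval_mpol_def
  by (rule sum.mono_neutral_left) (use assms in \<open>auto simp: Poly_Mapping.in_keys_iff\<close>)

lemma eval_mpol_zero [simp]: "eval_mpol h b 0 = 0"
  by (simp add: eval_mpol_def)

lemma eval_mpol_single:
  assumes "h 0 = 0"
  shows "eval_mpol h b (Poly_Mapping.single m a) = h a * (\<Prod>i\<in>UNIV. b i ^ Poly_Mapping.lookup m i)"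
  using eval_mpol_superset[of h "{m}" "Poly_Mapping.single m a" b] assms
  by (simp add: Poly_Mapping.lookup_single)

lemma eval_mpol_add:
  assumes "h 0 = 0" "\<And>x y. h (x + y) = h x + h y"
  shows "eval_mpol h b (f + g) = eval_mpol h b f + eval_mpol h b g"
proof -
  let ?S = "Poly_Mapping.keys f \<union> Poly_Mapping.keys g"
  have "Poly_Mapping.keys (f + g) \<subseteq> ?S" by (rule Poly_Mapping.keys_add)
  then show ?thesis
    using eval_mpol_superset[of h ?S _ b] assms
    by (simp add: Poly_Mapping.lookup_add distrib_right sum.distrib)
qed

lemma eval_mpol_sum:
  assumes "h 0 = 0" "\<And>x y. h (x + y) = h x + h y"
  shows "eval_mpol h b (sum F A) = (\<Sum>x\<in>A. eval_mpol h b (F x))"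
  by (induction A rule: infinite_finite_induct) (simp_all add: eval_mpol_add assms)

lemma mpol_sum_single:
  "f = (\<Sum>m\<in>Poly_Mapping.keys f. Poly_Mapping.single m (Poly_Mapping.lookup f m))"
proof (rule poly_mapping_eqI)
  fix k
  have "Poly_Mapping.lookup (\<Sum>m\<in>Poly_Mapping.keys f. Poly_Mapping.single m (Poly_Mapping.lookup f m)) k
      = (\<Sum>m\<in>Poly_Mapping.keys f. if m = k then Poly_Mapping.lookup f m else 0)"
    by (simp add: Poly_Mapping.lookup_sum Poly_Mapping.lookup_single when_def)
  also have "\<dots> = Poly_Mapping.lookup f k"
    by (auto simp: Poly_Mapping.in_keys_iff)
  finally show "Poly_Mapping.lookup f k = Poly_Mapping.lookup
      (\<Sum>m\<in>Poly_Mapping.keys f. Poly_Mapping.single m (Poly_Mapping.lookup f m)) k" by simp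
qed

lemma eval_mpol_mult:
  fixes h :: "'a::comm_semiring_1 \<Rightarrow> 'b::comm_semiring_1"
  assumes h: "h 0 = 0" "\<And>x y. h (x + y) = h x + h y" "\<And>x y. h (x * y) = h x * h y"
  shows "eval_mpol h b (f * g) = eval_mpol h b f * eval_mpol h b g"
proof -
  let ?F = "\<lambda>m. Poly_Mapping.single m (Poly_Mapping.lookup f m)"
  let ?G = "\<lambda>m. Poly_Mapping.single m (Poly_Mapping.lookup g m)"
  let ?e = "eval_mpol h b"
  have s: "?e (?F m * ?G m') = ?e (?F m) * ?e (?G m')" for m m'
    by (simp add: Poly_Mapping.mult_single eval_mpol_single h Poly_Mapping.lookup_add power_add
        prod.distrib algebra_simps)
  have "f * g = sum ?F (Poly_Mapping.keys f) * sum ?G (Poly_Mapping.keys g)"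
    using mpol_sum_single[of f] mpol_sum_single[of g] by simp
  also have "\<dots> = (\<Sum>m\<in>Poly_Mapping.keys f. \<Sum>m'\<in>Poly_Mapping.keys g. ?F m * ?G m')"
    by (simp add: sum_product)
  finally have "?e (f * g) = ?e (sum ?F (Poly_Mapping.keys f)) * ?e (sum ?G (Poly_Mapping.keys g))"
    by (simp add: eval_mpol_sum h s sum_product)
  then show ?thesis
    using mpol_sum_single[of f] mpol_sum_single[of g] by simp
qed

section \<open>Berkovich affine space\<close>

definition is_berk_seminorm ::
    "(('n::finite, 'a::complete_nonarch_field) mpol \<Rightarrow> real) \<Rightarrow> bool" where
  "is_berk_seminorm s \<longleftrightarrow>
     (\<forall>f. 0 \<le> s f) \<and>
     (\<forall>a. s (mpol_const a) = nabs a) \<and>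
     (\<forall>f g. s (f + g) \<le> max (s f) (s g)) \<and>
     (\<forall>f g. s (f * g) = s f * s g)"

lemma is_berk_seminorm_eval: "is_berk_seminorm (\<lambda>f. nabs (eval_mpol (\<lambda>x. x) b f))"
  unfolding is_berk_seminorm_def
  by (simp add: eval_mpol_add eval_mpol_mult nabs_mult nabs_add_max mpol_const_def
      eval_mpol_single)

typedef (overloaded) ('n, 'a) berk_affine =
    "{s :: ('n::finite, 'a::complete_nonarch_field) mpol \<Rightarrow> real. is_berk_seminorm s}"
  morphisms berk_seminorm Abs_berk_affine
  using is_berk_seminorm_eval by blast

instantiation berk_affine :: (finite, complete_nonarch_field) topological_space
begin

text \<open>The weakest topology for which all evaluations of seminorms at polynomials are continuous.\<close>

definition open_berk_affine :: "('a, 'b) berk_affine set \<Rightarrow> bool" where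
  "open_berk_affine = generate_topology {{\<zeta>. berk_seminorm \<zeta> f \<in> U} | f U. open U}"

instance
  by standard (auto simp: open_berk_affine_def intro: generate_topology.intros)

end

definition berk_origin :: "('n::finite, 'a::complete_nonarch_field) berk_affine" where
  "berk_origin = Abs_berk_affine (\<lambda>f. nabs (eval_mpol (\<lambda>x. x) (\<lambda>_. 0) f))"

definition berk_norm :: "('n::finite, 'a::complete_nonarch_field) berk_affine \<Rightarrow> real" where
  "berk_norm \<zeta> = Max (range (\<lambda>i. berk_seminorm \<zeta> (mpol_var i)))"

lemma ex_berk_affine_neq_origin:
  "\<exists>\<zeta> :: ('n::finite, 'a::complete_nonarch_field) berk_affine. \<zeta> \<noteq> berk_origin"
proof -
  define i :: 'n where "i = undefined"
  define \<zeta> :: "('n, 'a) berk_affine" where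
    "\<zeta> = Abs_berk_affine (\<lambda>f. nabs (eval_mpol (\<lambda>x. x) (\<lambda>_. 1) f))"
  have "(\<Prod>j\<in>UNIV. (0::'a) ^ Poly_Mapping.lookup (Poly_Mapping.single i (1::nat)) j) = 0"
    by (rule prod_zero[OF finite]) (auto intro!: exI[of _ i])
  then have "berk_seminorm berk_origin (mpol_var i :: ('n, 'a) mpol) = 0"
    by (simp add: berk_origin_def Abs_berk_affine_inverse is_berk_seminorm_eval mpol_var_def
        eval_mpol_single)
  moreover have "berk_seminorm \<zeta> (mpol_var i) = 1"
    by (simp add: \<zeta>_def Abs_berk_affine_inverse is_berk_seminorm_eval mpol_var_def
        eval_mpol_single)
  ultimately have "\<zeta> \<noteq> berk_origin" by auto
  then show ?thesis ..
qed

section \<open>Berkovich projective space\<close>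

definition berk_proj_rel ::
    "('n::finite, 'a::complete_nonarch_field) berk_affine \<Rightarrow> ('n, 'a) berk_affine \<Rightarrow> bool" where
  "berk_proj_rel \<zeta> \<xi> \<longleftrightarrow> \<zeta> \<noteq> berk_origin \<and> \<xi> \<noteq> berk_origin \<and>
     (\<exists>c>0. \<forall>d f. homogeneous_mpol d f \<longrightarrow> berk_seminorm \<zeta> f = c ^ d * berk_seminorm \<xi> f)"

lemma part_equivp_berk_proj_rel: "part_equivp berk_proj_rel"
proof (rule part_equivpI)
  obtain \<zeta> :: "('a, 'b) berk_affine" where "\<zeta> \<noteq> berk_origin"
    using ex_berk_affine_neq_origin by blast
  then have "berk_proj_rel \<zeta> \<zeta>"
    by (auto simp: berk_proj_rel_def intro!: exI[of _ 1])
  then show "\<exists>\<zeta> :: ('a, 'b) berk_affine. berk_proj_rel \<zeta> \<zeta>" ..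
  show "symp (berk_proj_rel :: ('a, 'b) berk_affine \<Rightarrow> _)"
  proof (rule sympI)
    fix \<zeta> \<xi> :: "('a, 'b) berk_affine"
    assume "berk_proj_rel \<zeta> \<xi>"
    then obtain c where *: "\<zeta> \<noteq> berk_origin" "\<xi> \<noteq> berk_origin" "c > 0"
      "\<And>d f. homogeneous_mpol d f \<Longrightarrow> berk_seminorm \<zeta> f = c ^ d * berk_seminorm \<xi> f"
      by (auto simp: berk_proj_rel_def)
    then have "berk_seminorm \<xi> f = (1 / c) ^ d * berk_seminorm \<zeta> f" if "homogeneous_mpol d f" for d f
      using that by (simp add: power_divide)
    with * show "berk_proj_rel \<xi> \<zeta>"
      unfolding berk_proj_rel_def by (intro conjI exI[of _ "1 / c"]) auto
  qed
  show "transp (berk_proj_rel :: ('a, 'b) berk_affine \<Rightarrow> _)"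
  proof (rule transpI)
    fix \<zeta> \<xi> \<eta> :: "('a, 'b) berk_affine"
    assume "berk_proj_rel \<zeta> \<xi>" "berk_proj_rel \<xi> \<eta>"
    then obtain c c' where *: "\<zeta> \<noteq> berk_origin" "\<eta> \<noteq> berk_origin" "c > 0" "c' > 0"
      "\<And>d f. homogeneous_mpol d f \<Longrightarrow> berk_seminorm \<zeta> f = c ^ d * berk_seminorm \<xi> f"
      "\<And>d f. homogeneous_mpol d f \<Longrightarrow> berk_seminorm \<xi> f = c' ^ d * berk_seminorm \<eta> f"
      by (auto simp: berk_proj_rel_def)
    then show "berk_proj_rel \<zeta> \<eta>"
      unfolding berk_proj_rel_def
      by (intro conjI exI[of _ "c * c'"]) (auto simp: power_mult_distrib)
  qed
qed

quotient_type (overloaded) ('n, 'a) berk_proj =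
    "('n::finite, 'a::complete_nonarch_field) berk_affine" / partial: berk_proj_rel
  by (rule part_equivp_berk_proj_rel)

text \<open>The projection is meaningful only away from the origin.\<close>

definition berk_pi :: "('n::finite, 'a::complete_nonarch_field) berk_affine \<Rightarrow> ('n, 'a) berk_proj" where
  "berk_pi = abs_berk_proj"

instantiation berk_proj :: (finite, complete_nonarch_field) topological_space
begin

definition open_berk_proj :: "('a, 'b) berk_proj set \<Rightarrow> bool" where
  "open_berk_proj U \<longleftrightarrow>
     openin (top_of_set (- {berk_origin})) {\<zeta> \<in> - {berk_origin}. berk_pi \<zeta> \<in> U}"

instance
proof
  let ?A = "- {berk_origin :: ('a, 'b) berk_affine}"
  let ?q = "\<lambda>U :: ('a, 'b) berk_proj set. {\<zeta> \<in> ?A. berk_pi \<zeta> \<in> U}"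
  have UNIV: "?q UNIV = ?A" by (simp only: UNIV_I simp_thms Collect_mem_eq)
  show "open (UNIV :: ('a, 'b) berk_proj set)"
    unfolding open_berk_proj_def UNIV by (rule openin_subtopology_refl[THEN iffD2]) simp
  show "open (S \<inter> T)" if "open S" "open T" for S T :: "('a, 'b) berk_proj set"
  proof -
    have "?q (S \<inter> T) = ?q S \<inter> ?q T" by blast
    then show ?thesis
      using that unfolding open_berk_proj_def by (simp only: openin_Int)
  qed
  show "open (\<Union>K)" if "\<forall>S\<in>K. open S" for K :: "('a, 'b) berk_proj set set"
  proof -
    have "?q (\<Union>K) = (\<Union>S\<in>K. ?q S)" by blast
    moreover have "openin (top_of_set ?A) (\<Union>S\<in>K. ?q S)"
      by (rule openin_Union) (use that in \<open>unfold open_berk_proj_def, blast\<close>)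
    ultimately show ?thesis
      by (simp only: open_berk_proj_def)
  qed
qed

end

section \<open>The scheme-theoretic projective space\<close>

text \<open>Ideals of the polynomial ring are those of the HOL-Algebra ring carried by the type.\<close>

abbreviation mpol_ring :: "('n, 'a::comm_ring_1) mpol ring" where
  "mpol_ring \<equiv> ring_of_type_algebra"

text \<open>The ideal generated by the homogeneous elements of \<open>I\<close>.\<close>

definition homogeneous_part :: "('n::finite, 'a::comm_ring_1) mpol set \<Rightarrow> ('n, 'a) mpol set" where
  "homogeneous_part I = genideal mpol_ring {f \<in> I. \<exists>d. homogeneous_mpol d f}"

text \<open>Proj: homogeneous prime ideals which do not contain the irrelevant ideal
  (the ideal generated by the indeterminates).\<close>

definition Proj :: "('n::finite, 'a::field) mpol set set" where
  "Proj = {p. primeideal p mpol_ring \<and> homogeneous_part p = p \<and> \<not> range mpol_var \<subseteq> p}"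

definition Proj_closed :: "('n::finite, 'a::field) mpol set set \<Rightarrow> bool" where
  "Proj_closed W \<longleftrightarrow>
     (\<exists>I. ideal I mpol_ring \<and> homogeneous_part I = I \<and> W = {p \<in> Proj. I \<subseteq> p})"

section \<open>The reduction map\<close>

definition small_ideal :: "('n::finite, 'a::complete_nonarch_field) berk_affine \<Rightarrow> ('n, 'a) mpol set" where
  "small_ideal \<zeta> =
     {f. (\<forall>m. nabs (Poly_Mapping.lookup f m) \<le> 1) \<and> berk_seminorm \<zeta> f < 1}"

definition berk_reduction ::
    "('n::finite, 'a::complete_nonarch_field) berk_proj \<Rightarrow> ('n, 'a residue_field) mpol set" where
  "berk_reduction z =
     (let \<zeta> = (SOME \<zeta>. \<zeta> \<noteq> berk_origin \<and> berk_pi \<zeta> = z \<and> berk_norm \<zeta> = 1)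
      in homogeneous_part (Poly_Mapping.map residue ` small_ideal \<zeta>))"

section \<open>Nets of finite multisets\<close>

definition directed_set :: "'i set \<Rightarrow> ('i \<Rightarrow> 'i \<Rightarrow> bool) \<Rightarrow> bool" where
  "directed_set D R \<longleftrightarrow> D \<noteq> {} \<and> reflp_on D R \<and> transp_on D R \<and>
     (\<forall>a\<in>D. \<forall>b\<in>D. \<exists>c\<in>D. R a c \<and> R b c)"

text \<open>Convergence along this filter is convergence of nets indexed by \<open>D\<close>.\<close>

definition net_filter :: "'i set \<Rightarrow> ('i \<Rightarrow> 'i \<Rightarrow> bool) \<Rightarrow> 'i filter" where
  "net_filter D R = (INF a\<in>D. principal {b \<in> D. R a b})"

lemma eventually_net_filter:
  assumes "directed_set D R"
  shows "eventually P (net_filter D R) \<longleftrightarrow> (\<exists>a\<in>D. \<forall>b\<in>D. R a b \<longrightarrow> P b)"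
proof -
  have "eventually P (net_filter D R) \<longleftrightarrow> (\<exists>a\<in>D. eventually P (principal {b \<in> D. R a b}))"
    unfolding net_filter_def
  proof (rule eventually_INF_base)
    show "D \<noteq> {}" using assms by (simp add: directed_set_def)
    fix a b assume ab: "a \<in> D" "b \<in> D"
    then obtain c where c: "c \<in> D" "R a c" "R b c"
      using assms by (auto simp: directed_set_def)
    have "R a d \<and> R b d" if "d \<in> D" "R c d" for d
      using assms ab c that unfolding directed_set_def by (metis transp_onD)
    with c show "\<exists>x\<in>D. principal {b \<in> D. R x b} \<le>
        inf (principal {b \<in> D. R a b}) (principal {c \<in> D. R b c})"
      by (intro bexI[of _ c]) auto
  qed
  then show ?thesis by (auto simp: eventually_principal)
qed

definition weakly_generic ::
    "'i filter \<Rightarrow> ('i \<Rightarrow> ('n::finite, 'a::field) mpol set multiset) \<Rightarrow> bool" where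
  "weakly_generic F Z \<longleftrightarrow>
     (\<forall>W. Proj_closed W \<and> W \<noteq> Proj \<longrightarrow>
        ((\<lambda>\<alpha>. real (size (filter_mset (\<lambda>z. z \<in> W) (Z \<alpha>))) / real (size (Z \<alpha>))) \<longlongrightarrow> 0) F)"

definition equidistributed ::
    "('n::finite, 'a::complete_nonarch_field) berk_proj measure \<Rightarrow> 'i filter
      \<Rightarrow> ('i \<Rightarrow> ('n, 'a) berk_proj multiset) \<Rightarrow> bool" where
  "equidistributed \<mu> F Z \<longleftrightarrow>
     (\<forall>\<phi> :: ('n, 'a) berk_proj \<Rightarrow> real. continuous_on UNIV \<phi> \<longrightarrow>
        ((\<lambda>\<alpha>. (\<Sum>z\<in>#Z \<alpha>. \<phi> z) / real (size (Z \<alpha>))) \<longlongrightarrow> (\<integral>z. \<phi> z \<partial>\<mu>)) F)"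

section \<open>The Gauss point\<close>

text \<open>Via \<open>j\<close>, the complete field \<^typ>\<open>'c\<close> is the completion of the algebraic closure of
  \<^typ>\<open>'a\<close>. Pulled back along \<open>j\<close>, the nabs of \<^typ>\<open>'c\<close> is an absolute value on the algebraic
  closure extending the one of \<^typ>\<open>'a\<close>, hence the unique such extension.\<close>

definition completed_alg_closure ::
    "('a::complete_nonarch_field alg_closure \<Rightarrow> 'c::complete_nonarch_field) \<Rightarrow> bool" where
  "completed_alg_closure j \<longleftrightarrow>
     j 1 = 1 \<and> (\<forall>x y. j (x + y) = j x + j y) \<and> (\<forall>x y. j (x * y) = j x * j y) \<and>
     (\<forall>a. nabs (j (to_ac a)) = nabs a) \<and>
     closure (range j) = UNIV"

text \<open>The seminorm taking the supremum of absolute values over the closed unit polydisc of the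
  completed algebraic closure. It is unique because points are determined by their seminorms,
  and it exists when \<open>j\<close> is as above, that supremum being multiplicative.\<close>

definition gauss_affine ::
    "('a::complete_nonarch_field alg_closure \<Rightarrow> 'c::complete_nonarch_field)
      \<Rightarrow> ('n::finite, 'a) berk_affine" where
  "gauss_affine j = (THE \<zeta>. \<forall>f. berk_seminorm \<zeta> f =
     (SUP b\<in>{b. \<forall>n. nabs (b n) \<le> 1}. nabs (eval_mpol (\<lambda>a. j (to_ac a)) b f)))"

definition gauss_point ::
    "('a::complete_nonarch_field alg_closure \<Rightarrow> 'c::complete_nonarch_field)
      \<Rightarrow> ('n::finite, 'a) berk_proj" where
  "gauss_point j = berk_pi (gauss_affine j)"

end

theory Submission
  imports Defs
begin

text \<open>
  A continuous function on projective space can deviate noticeably from its value at the Gauss point only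
  outside a neighbourhood of that point, so it suffices that a generic net puts a vanishing
  proportion of its points there. The link to the reduction is that the Gauss point is the only
  point reducing to the generic point: a normalized representative \<open>\<zeta>\<close> of any other point makes
  some homogeneous polynomial of Gauss norm 1 smaller than 1
  (\<open>ex_homogeneous_small_if_neq_gauss\<close>), and the reduction of that polynomial is nonzero and vanishes
  at the reduction of the point. As the unit sphere of affine space is compact
  (\<open>compact_berk_unit_sphere\<close>), finitely many such polynomials serve all points away from the Gauss
  point (\<open>finite_hypersurface_cover\<close>). So these points reduce into finitely many hypersurfaces, each
  of which a weakly generic net avoids asymptotically; their contribution vanishes because the function is bounded, again by
  compactness.

  Four facts support this. The Gauss norm is multiplicative and equals the supremum over the unit
  polydisc of the completed algebraic closure (\<open>is_berk_seminorm_gauss_norm\<close>,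
  \<open>SUP_nabs_eval_eq_gauss_norm\<close>), so the Gauss point is given by the largest coefficient. Every point
  has a representative of norm 1 (\<open>ex_normalized_representative\<close>). The reduction of a point is a
  homogeneous prime ideal (\<open>homogeneous_part_reduce_small_ideal_in_Proj\<close>). The zero ideal is
  prime (\<open>zero_ideal_in_Proj\<close>), so hypersurfaces are proper closed sets. The first three rest on one
  construction, the regrading of a seminorm (\<open>is_berk_seminorm_graded\<close>), and the last one follows
  from the multiplicativity of the Gauss norm.
\<close>

section \<open>Seminorms and gradings\<close>

lemma berk_seminormD:
  assumes "is_berk_seminorm s"
  shows "0 \<le> s f" "s (mpol_const a) = nabs a" "s (f + g) \<le> max (s f) (s g)" "s (f * g) = s f * s g"
  using assms by (auto simp: is_berk_seminorm_def)

lemma mpol_const_0 [simp]: "mpol_const 0 = 0"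
  by (simp add: mpol_const_def)

lemma mpol_const_1 [simp]: "mpol_const 1 = 1"
  by (simp add: mpol_const_def)

lemma berk_seminorm_0: "is_berk_seminorm s \<Longrightarrow> s 0 = 0"
  using berk_seminormD(2)[of s 0] by simp

lemma berk_seminorm_1: "is_berk_seminorm s \<Longrightarrow> s 1 = 1"
  using berk_seminormD(2)[of s 1] by simp

lemma berk_seminorm_uminus:
  assumes "is_berk_seminorm s" shows "s (- f) = s f"
proof -
  have "- f = mpol_const (- 1) * f"
    by (simp add: mpol_const_def Poly_Mapping.single_uminus)
  then show ?thesis
    using berk_seminormD(2,4)[OF assms] by simp
qed

lemma berk_seminorm_diff:
  assumes "is_berk_seminorm s" shows "s (f - g) \<le> max (s f) (s g)"
  using berk_seminormD(3)[OF assms, of f "- g"] berk_seminorm_uminus[OF assms, of g] by simp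

lemma berk_seminorm_sum_le:
  assumes "is_berk_seminorm s" "0 \<le> B" "\<And>x. x \<in> A \<Longrightarrow> s (F x) \<le> B"
  shows "s (sum F A) \<le> B"
  using assms(3)
proof (induction A rule: infinite_finite_induct)
  case (insert x A)
  then show ?case
    using berk_seminormD(3)[OF assms(1), of "F x" "sum F A"] insert.prems[of x] by fastforce
qed (use assms in \<open>auto simp: berk_seminorm_0\<close>)

lemma berk_seminorm_sum_less:
  assumes "is_berk_seminorm s" "0 < B" "\<And>x. x \<in> A \<Longrightarrow> s (F x) < B"
  shows "s (sum F A) < B"
  using assms(3)
proof (induction A rule: infinite_finite_induct)
  case (insert x A)
  then show ?case
    using berk_seminormD(3)[OF assms(1), of "F x" "sum F A"] insert.prems[of x] by fastforce
qed (use assms in \<open>auto simp: berk_seminorm_0\<close>)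

text \<open>In an ultrametric sum a strictly dominant term determines the size.\<close>

lemma berk_seminorm_add_dominant:
  assumes "is_berk_seminorm s" "s g < s f"
  shows "s (f + g) = s f"
  using berk_seminormD(3)[OF assms(1), of f g] berk_seminorm_diff[OF assms(1), of "f + g" g] assms(2)
  by auto

text \<open>The part of a polynomial supported on a set of exponents. For the fibre of a grading of the
  exponents this is the homogeneous component of the given degree.\<close>

lift_definition mpol_part :: "'m set \<Rightarrow> ('m \<Rightarrow>\<^sub>0 'b::zero) \<Rightarrow> ('m \<Rightarrow>\<^sub>0 'b)"
  is "\<lambda>A f m. if m \<in> A then f m else 0"
  by (rule finite_subset[rotated]) auto

lemma keys_mpol_part: "Poly_Mapping.keys (mpol_part A f) = Poly_Mapping.keys f \<inter> A"
  by (auto simp: Poly_Mapping.in_keys_iff mpol_part.rep_eq split: if_splits)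

lemma mpol_part_add:
  "mpol_part A (f + g) = mpol_part A f + mpol_part A (g :: 'm \<Rightarrow>\<^sub>0 'b::monoid_add)"
  by (rule poly_mapping_eqI) (simp add: mpol_part.rep_eq Poly_Mapping.lookup_add)

lemma mpol_part_0 [simp]: "mpol_part A 0 = 0"
  by (rule poly_mapping_eqI) (simp add: mpol_part.rep_eq)

lemma mpol_part_sum:
  "mpol_part A (sum F I) = (\<Sum>i\<in>I. mpol_part A (F i :: 'm \<Rightarrow>\<^sub>0 'b::comm_monoid_add))"
  by (induction I rule: infinite_finite_induct) (simp_all add: mpol_part_add)

lemma mpol_part_eq_0: "Poly_Mapping.keys f \<inter> A = {} \<Longrightarrow> mpol_part A f = 0"
  using keys_mpol_part[of A f] by simp

lemma mpol_part_id: "Poly_Mapping.keys f \<subseteq> A \<Longrightarrow> mpol_part A f = f"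
  by (rule poly_mapping_eqI) (auto simp: mpol_part.rep_eq Poly_Mapping.in_keys_iff)

lemma sum_mpol_part:
  assumes "finite A" "g ` Poly_Mapping.keys f \<subseteq> A"
  shows "(\<Sum>a\<in>A. mpol_part (g -` {a}) f) = (f :: 'm \<Rightarrow>\<^sub>0 'b::comm_monoid_add)"
proof (rule poly_mapping_eqI)
  fix m
  have "Poly_Mapping.lookup (\<Sum>a\<in>A. mpol_part (g -` {a}) f) m
      = (\<Sum>a\<in>A. if a = g m then Poly_Mapping.lookup f m else 0)"
    by (auto simp: Poly_Mapping.lookup_sum mpol_part.rep_eq intro: sum.cong)
  also have "\<dots> = Poly_Mapping.lookup f m"
    using assms by (cases "m \<in> Poly_Mapping.keys f") (auto simp: Poly_Mapping.in_keys_iff)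
  finally show "Poly_Mapping.lookup (\<Sum>a\<in>A. mpol_part (g -` {a}) f) m = Poly_Mapping.lookup f m" .
qed

text \<open>The grading \<open>g\<close> makes the polynomial ring a graded ring, so the components multiply by convolution.\<close>

lemma mpol_part_mult:
  fixes f h :: "('n, 'a::comm_ring_1) mpol" and g :: "_ \<Rightarrow> 'g::ab_semigroup_add"
  assumes g: "\<And>m m'. g (m + m') = g m + g m'"
  shows "mpol_part (g -` {c}) (f * h) =
    (\<Sum>(a, b)\<in>{p \<in> (g ` Poly_Mapping.keys f) \<times> (g ` Poly_Mapping.keys h). fst p + snd p = c}.
       mpol_part (g -` {a}) f * mpol_part (g -` {b}) h)"
proof -
  let ?A = "g ` Poly_Mapping.keys f" and ?B = "g ` Poly_Mapping.keys h"
  let ?F = "\<lambda>a. mpol_part (g -` {a}) f" and ?H = "\<lambda>b. mpol_part (g -` {b}) h"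
  have k: "Poly_Mapping.keys (?F a * ?H b) \<subseteq> g -` {a + b}" for a b
    using Poly_Mapping.keys_mult[of "?F a" "?H b"] by (fastforce simp: keys_mpol_part g)
  have part: "mpol_part (g -` {c}) (?F a * ?H b) = (if a + b = c then ?F a * ?H b else 0)" for a b
    using k[of a b] by (auto intro!: mpol_part_id mpol_part_eq_0)
  have "f * h = (\<Sum>a\<in>?A. ?F a) * (\<Sum>b\<in>?B. ?H b)"
    by (simp add: sum_mpol_part)
  also have "\<dots> = (\<Sum>p\<in>?A \<times> ?B. ?F (fst p) * ?H (snd p))"
    by (simp add: sum_product sum.cartesian_product case_prod_unfold)
  finally have "mpol_part (g -` {c}) (f * h) =
      (\<Sum>p\<in>?A \<times> ?B. if fst p + snd p = c then ?F (fst p) * ?H (snd p) else 0)"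
    by (simp add: mpol_part_sum part)
  also have "\<dots> = (\<Sum>p\<in>{p \<in> ?A \<times> ?B. fst p + snd p = c}. ?F (fst p) * ?H (snd p))"
    by (subst sum.inter_filter) auto
  finally show ?thesis by (simp add: case_prod_unfold)
qed

text \<open>Given a grading \<open>g\<close> of the exponents, measure a polynomial by the largest of its components,
  where the component of degree \<open>a\<close> is rescaled by \<open>\<rho> a\<close>. Grading by the exponents themselves
  turns evaluation at the point with all coordinates 1 into the Gauss norm. Grading by the total
  degree with \<open>\<rho> d = c ^ d\<close> produces the other representatives of a point of projective space, and
  \<open>c = 1\<close> gives one whose small ideal is homogeneous. The 0 in the maximum is the value at the zero
  polynomial.\<close>

definition graded_seminorm ::
    "('g \<Rightarrow> real) \<Rightarrow> (('n \<Rightarrow>\<^sub>0 nat) \<Rightarrow> 'g) \<Rightarrow> (('n, 'a::zero) mpol \<Rightarrow> real) \<Rightarrow> ('n, 'a) mpol \<Rightarrow> real" where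
  "graded_seminorm \<rho> g s f =
     Max (insert 0 ((\<lambda>a. \<rho> a * s (mpol_part (g -` {a}) f)) ` g ` Poly_Mapping.keys f))"

lemma graded_seminorm_nonneg: "0 \<le> graded_seminorm \<rho> g s f"
  unfolding graded_seminorm_def by (rule Max_ge) auto

lemma graded_seminorm_ge:
  assumes "s 0 = 0"
  shows "\<rho> a * s (mpol_part (g -` {a}) f) \<le> graded_seminorm \<rho> g s f"
proof (cases "a \<in> g ` Poly_Mapping.keys f")
  case True
  then show ?thesis unfolding graded_seminorm_def by (intro Max_ge) auto
next
  case False
  then have "mpol_part (g -` {a}) f = 0" by (intro mpol_part_eq_0) auto
  then show ?thesis using assms graded_seminorm_nonneg[of \<rho> g s f] by simp
qed

lemma graded_seminorm_le:
  assumes "0 \<le> B" "\<And>a. \<rho> a * s (mpol_part (g -` {a}) f) \<le> B"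
  shows "graded_seminorm \<rho> g s f \<le> B"
  unfolding graded_seminorm_def using assms by (intro Max.boundedI) auto

lemma graded_seminorm_attained:
  assumes "0 < graded_seminorm \<rho> g s f"
  shows "\<exists>a\<in>g ` Poly_Mapping.keys f. \<rho> a * s (mpol_part (g -` {a}) f) = graded_seminorm \<rho> g s f"
proof -
  have "graded_seminorm \<rho> g s f \<in>
      insert 0 ((\<lambda>a. \<rho> a * s (mpol_part (g -` {a}) f)) ` g ` Poly_Mapping.keys f)"
    unfolding graded_seminorm_def by (rule Max_in) auto
  with assms show ?thesis by auto
qed

lemma graded_seminorm_first_attained:
  fixes g :: "_ \<Rightarrow> 'g::linorder"
  assumes "0 < graded_seminorm \<rho> g s f" "s 0 = 0"
  obtains a where "a \<in> g ` Poly_Mapping.keys f"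
    "\<rho> a * s (mpol_part (g -` {a}) f) = graded_seminorm \<rho> g s f"
    "\<And>a'. a' < a \<Longrightarrow> \<rho> a' * s (mpol_part (g -` {a'}) f) < graded_seminorm \<rho> g s f"
proof -
  let ?M = "{a \<in> g ` Poly_Mapping.keys f. \<rho> a * s (mpol_part (g -` {a}) f) = graded_seminorm \<rho> g s f}"
  have M: "finite ?M" "?M \<noteq> {}"
    using graded_seminorm_attained[OF assms(1)] by auto
  have "\<rho> a' * s (mpol_part (g -` {a'}) f) < graded_seminorm \<rho> g s f" if "a' < Min ?M" for a'
  proof (cases "a' \<in> g ` Poly_Mapping.keys f")
    case True
    then have "a' \<notin> ?M" using Min_le[OF M(1)] that leD by blast
    with True have "\<rho> a' * s (mpol_part (g -` {a'}) f) \<noteq> graded_seminorm \<rho> g s f" by blast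
    with graded_seminorm_ge[of s \<rho> a' g f] assms(2) show ?thesis by (simp add: order.strict_iff_order)
  next
    case False
    then have "mpol_part (g -` {a'}) f = 0" by (intro mpol_part_eq_0) auto
    then show ?thesis using assms by simp
  qed
  with Min_in[OF M] show ?thesis by (intro that[of "Min ?M"]) auto
qed

text \<open>Multiplicativity is the content. As degrees are linearly ordered, each factor has a least degree
  at which its maximum is attained. In the component of the product at the sum of these two degrees,
  every other pair of degrees contains one that lies below the least maximal one, so its
  contribution is strictly smaller and the product of the two chosen components dominates. Hence the
  order on the degrees is what excludes cancellation.\<close>

proposition is_berk_seminorm_graded:
  fixes g :: "('n::finite \<Rightarrow>\<^sub>0 nat) \<Rightarrow> 'g::{linorder, ordered_cancel_comm_monoid_add}"
    and s :: "('n, 'a::complete_nonarch_field) mpol \<Rightarrow> real"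
  assumes s: "is_berk_seminorm s"
    and g: "g 0 = 0" "\<And>m m'. g (m + m') = g m + g m'"
    and \<rho>: "\<rho> 0 = 1" "\<And>a b. \<rho> (a + b) = \<rho> a * \<rho> b" "\<And>a. 0 < \<rho> a"
  shows "is_berk_seminorm (graded_seminorm \<rho> g s)"
  unfolding is_berk_seminorm_def
proof (intro conjI allI)
  let ?S = "graded_seminorm \<rho> g s"
  let ?p = "\<lambda>a. mpol_part (g -` {a})"
  note s0 = berk_seminorm_0[OF s]
  note nn = graded_seminorm_nonneg
  show "0 \<le> ?S f" for f by (rule nn)
  show "?S (mpol_const c) = nabs c" for c
  proof (rule antisym)
    have k: "?p a (mpol_const c) = (if a = 0 then mpol_const c else 0)" for a
      using g(1) by (auto intro!: mpol_part_id mpol_part_eq_0 simp: mpol_const_def split: if_splits)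
    show "?S (mpol_const c) \<le> nabs c"
      by (rule graded_seminorm_le) (auto simp: k \<rho> s0 berk_seminormD(2)[OF s])
    show "nabs c \<le> ?S (mpol_const c)"
      using graded_seminorm_ge[of s \<rho> 0 g "mpol_const c", OF s0]
      by (simp add: k \<rho> berk_seminormD(2)[OF s])
  qed
  show "?S (f + h) \<le> max (?S f) (?S h)" for f h
  proof (rule graded_seminorm_le)
    fix a
    have "\<rho> a * s (?p a (f + h)) \<le> \<rho> a * max (s (?p a f)) (s (?p a h))"
      unfolding mpol_part_add
      by (intro mult_left_mono berk_seminormD(3)[OF s] less_imp_le \<rho>)
    also have "\<dots> \<le> max (?S f) (?S h)"
      using graded_seminorm_ge[of s \<rho> a g f, OF s0] graded_seminorm_ge[of s \<rho> a g h, OF s0]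
      by (auto simp: max_def)
    finally show "\<rho> a * s (?p a (f + h)) \<le> max (?S f) (?S h)" .
  qed (simp add: nn le_max_iff_disj)
  show "?S (f * h) = ?S f * ?S h" for f h
  proof (rule antisym)
    let ?I = "\<lambda>c. {p \<in> (g ` Poly_Mapping.keys f) \<times> (g ` Poly_Mapping.keys h). fst p + snd p = c}"
    let ?T = "\<lambda>p. ?p (fst p) f * ?p (snd p) h"
    have part: "?p c (f * h) = sum ?T (?I c)" for c
      using mpol_part_mult[of g c f h, OF g(2)] by (simp add: case_prod_unfold)
    have T: "\<rho> c * s (?T p) = (\<rho> (fst p) * s (?p (fst p) f)) * (\<rho> (snd p) * s (?p (snd p) h))"
      if "fst p + snd p = c" for c p
      using that[symmetric] by (simp add: \<rho> berk_seminormD(4)[OF s])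
    show "?S (f * h) \<le> ?S f * ?S h"
    proof (rule graded_seminorm_le)
      fix c
      have "s (sum ?T (?I c)) \<le> ?S f * ?S h / \<rho> c"
      proof (rule berk_seminorm_sum_le[OF s])
        fix p assume p: "p \<in> ?I c"
        have "\<rho> c * s (?T p) \<le> ?S f * ?S h"
          unfolding T[of p c, OF conjunct2[OF p[simplified mem_Collect_eq]]]
          by (intro mult_mono graded_seminorm_ge[of s _ _ g, OF s0] nn mult_nonneg_nonneg
            less_imp_le[OF \<rho>(3)] berk_seminormD(1)[OF s])
        then show "s (?T p) \<le> ?S f * ?S h / \<rho> c"
          using \<rho>(3)[of c] by (simp add: field_simps)
      qed (simp add: nn less_imp_le[OF \<rho>(3)])
      then show "\<rho> c * s (?p c (f * h)) \<le> ?S f * ?S h"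
        using \<rho>(3)[of c] by (simp add: part field_simps)
    qed (simp add: nn)
    show "?S f * ?S h \<le> ?S (f * h)"
    proof (cases "?S f = 0 \<or> ?S h = 0")
      case True
      then show ?thesis using nn[of \<rho> g s "f * h"] by auto
    next
      case False
      then have pos: "0 < ?S f" "0 < ?S h"
        using nn[of \<rho> g s f] nn[of \<rho> g s h] by auto
      obtain a where a: "a \<in> g ` Poly_Mapping.keys f" "\<rho> a * s (?p a f) = ?S f"
        "\<And>a'. a' < a \<Longrightarrow> \<rho> a' * s (?p a' f) < ?S f"
        using graded_seminorm_first_attained[OF pos(1) s0] by metis
      obtain b where b: "b \<in> g ` Poly_Mapping.keys h" "\<rho> b * s (?p b h) = ?S h"
        "\<And>b'. b' < b \<Longrightarrow> \<rho> b' * s (?p b' h) < ?S h"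
        using graded_seminorm_first_attained[OF pos(2) s0] by metis
      \<comment> \<open>The degree at which the lower bound for the product is read off.\<close>
      define c where "c = a + b"
      have fin: "finite (?I c)"
        by (rule finite_subset[of _ "(g ` Poly_Mapping.keys f) \<times> (g ` Poly_Mapping.keys h)"]) auto
      have ab: "(a, b) \<in> ?I c" using a b by (simp add: c_def)
      have dom: "\<rho> c * s (?T (a, b)) = ?S f * ?S h"
        using T[of "(a, b)" c] a b by (simp add: c_def)
      have "s (sum ?T (?I c - {(a, b)})) < ?S f * ?S h / \<rho> c"
      proof (rule berk_seminorm_sum_less[OF s])
        fix p assume p: "p \<in> ?I c - {(a, b)}"
        obtain a' b' where [simp]: "p = (a', b')" by force
        have sum: "a' + b' = a + b" using p by (simp add: c_def)
        have "a' < a \<or> b' < b"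
        proof (rule ccontr)
          assume n: "\<not> (a' < a \<or> b' < b)"
          then have "a \<le> a'" "b \<le> b'" by auto
          moreover have "a \<noteq> a' \<or> b \<noteq> b'" using p by auto
          ultimately have "a + b < a' + b'"
            by (metis add_less_le_mono add_le_less_mono order_le_imp_less_or_eq)
          with sum show False by simp
        qed
        then have "(\<rho> a' * s (?p a' f)) * (\<rho> b' * s (?p b' h)) < ?S f * ?S h"
        proof
          assume "a' < a"
          then show ?thesis
            using a(3) graded_seminorm_ge[of s \<rho> b' g h, OF s0] pos(2)
              less_imp_le[OF \<rho>(3)] berk_seminormD(1)[OF s]
            by (intro le_less_trans[OF mult_left_mono mult_strict_right_mono]) auto
        next
          assume "b' < b"
          then show ?thesis
            using b(3) graded_seminorm_ge[of s \<rho> a' g f, OF s0] pos(1)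
              less_imp_le[OF \<rho>(3)] berk_seminormD(1)[OF s]
            by (intro le_less_trans[OF mult_right_mono mult_strict_left_mono]) auto
        qed
        then have "\<rho> c * s (?T p) < ?S f * ?S h"
          using T[of p c] sum by (simp add: c_def)
        then show "s (?T p) < ?S f * ?S h / \<rho> c"
          using \<rho>(3)[of c] by (simp add: field_simps)
      qed (simp add: pos \<rho>(3))
      also have "\<dots> = s (?T (a, b))"
        using dom \<rho>(3)[of c] by (simp add: field_simps)
      finally have "s (?T (a, b) + sum ?T (?I c - {(a, b)})) = s (?T (a, b))"
        by (rule berk_seminorm_add_dominant[OF s])
      then have "\<rho> c * s (?p c (f * h)) = ?S f * ?S h"
        using sum.remove[OF fin ab, of ?T] dom by (simp add: part)
      then show ?thesis using graded_seminorm_ge[of s \<rho> c g "f * h", OF s0] by simp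
    qed
  qed
qed

section \<open>The Gauss norm\<close>

definition gauss_norm :: "('n, 'a::complete_nonarch_field) mpol \<Rightarrow> real" where
  "gauss_norm f = Max (insert 0 ((\<lambda>m. nabs (Poly_Mapping.lookup f m)) ` Poly_Mapping.keys f))"

lemma gauss_norm_0 [simp]: "gauss_norm 0 = 0"
  by (simp add: gauss_norm_def)

lemma gauss_norm_nonneg: "0 \<le> gauss_norm f"
  unfolding gauss_norm_def by (rule Max_ge) auto

lemma nabs_coeff_le_gauss_norm: "nabs (Poly_Mapping.lookup f m) \<le> gauss_norm f"
proof (cases "m \<in> Poly_Mapping.keys f")
  case True
  then show ?thesis unfolding gauss_norm_def by (intro Max_ge) auto
qed (simp add: Poly_Mapping.in_keys_iff gauss_norm_nonneg)

lemma gauss_norm_leI: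
  "0 \<le> B \<Longrightarrow> (\<And>m. nabs (Poly_Mapping.lookup f m) \<le> B) \<Longrightarrow> gauss_norm f \<le> B"
  unfolding gauss_norm_def by (intro Max.boundedI) auto

lemma gauss_norm_lessI:
  "0 < B \<Longrightarrow> (\<And>m. nabs (Poly_Mapping.lookup f m) < B) \<Longrightarrow> gauss_norm f < B"
  unfolding gauss_norm_def by (subst Max_less_iff) auto

lemma gauss_norm_attained:
  assumes "f \<noteq> 0"
  obtains m where "m \<in> Poly_Mapping.keys f" "nabs (Poly_Mapping.lookup f m) = gauss_norm f"
proof -
  have "gauss_norm f \<in> insert 0 ((\<lambda>m. nabs (Poly_Mapping.lookup f m)) ` Poly_Mapping.keys f)"
    unfolding gauss_norm_def by (rule Max_in) auto
  moreover have "gauss_norm f \<noteq> 0"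
  proof -
    obtain m where "m \<in> Poly_Mapping.keys f" using assms by fastforce
    then have "0 < nabs (Poly_Mapping.lookup f m)"
      by (simp add: Poly_Mapping.in_keys_iff order.strict_iff_order)
    with nabs_coeff_le_gauss_norm[of f m] show ?thesis by linarith
  qed
  ultimately show ?thesis using that by fastforce
qed

lemma gauss_norm_var [simp]: "gauss_norm (mpol_var i) = 1"
proof (rule antisym)
  show "gauss_norm (mpol_var i) \<le> 1"
    by (rule gauss_norm_leI) (auto simp: mpol_var_def Poly_Mapping.lookup_single when_def)
  show "1 \<le> gauss_norm (mpol_var i)"
    using nabs_coeff_le_gauss_norm[of "mpol_var i" "Poly_Mapping.single i 1"]
    by (simp add: mpol_var_def)
qed

text \<open>Numbering the indeterminates embeds the exponents into finitely supported functions
  on \<^typ>\<open>nat\<close>, which are linearly ordered lexicographically and compatibly with addition. For this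
  grading the components are the single terms, and evaluation at the all-one point measures a
  term by its coefficient.\<close>

proposition is_berk_seminorm_gauss_norm:
  "is_berk_seminorm (gauss_norm :: ('n::finite, 'a::complete_nonarch_field) mpol \<Rightarrow> real)"
proof -
  obtain e :: "'n \<Rightarrow> nat" where e: "inj e"
    using finite_imp_inj_to_nat_seg[of "UNIV :: 'n set"] by auto
  define g :: "('n \<Rightarrow>\<^sub>0 nat) \<Rightarrow> (nat \<Rightarrow>\<^sub>0 nat)" where
    "g m = (\<Sum>i\<in>UNIV. Poly_Mapping.single (e i) (Poly_Mapping.lookup m i))" for m
  have lookup_g: "Poly_Mapping.lookup (g m) (e k) = Poly_Mapping.lookup m k" for m k
    using inj_eq[OF e] by (simp add: g_def Poly_Mapping.lookup_sum Poly_Mapping.lookup_single when_def)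
  have inj_g: "g m = g m' \<longleftrightarrow> m = m'" for m m'
    by (metis lookup_g poly_mapping_eqI)
  have g: "g 0 = 0" "g (m + m') = g m + g m'" for m m'
    by (simp_all add: g_def Poly_Mapping.lookup_add Poly_Mapping.single_add sum.distrib)
  define s :: "('n, 'a) mpol \<Rightarrow> real" where "s f = nabs (eval_mpol (\<lambda>x. x) (\<lambda>_. 1) f)" for f
  have s: "is_berk_seminorm s"
    unfolding s_def by (rule is_berk_seminorm_eval)
  have part: "s (mpol_part (g -` {g m}) f) = nabs (Poly_Mapping.lookup f m)" for f m
  proof -
    have "mpol_part (g -` {g m}) f = Poly_Mapping.single m (Poly_Mapping.lookup f m)"
      by (rule poly_mapping_eqI) (auto simp: mpol_part.rep_eq Poly_Mapping.lookup_single when_def inj_g)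
    then show ?thesis by (simp add: s_def eval_mpol_single)
  qed
  have "graded_seminorm (\<lambda>_. 1) g s = gauss_norm"
    by (rule ext) (simp add: graded_seminorm_def gauss_norm_def image_image part)
  moreover have "is_berk_seminorm (graded_seminorm (\<lambda>_. 1) g s)"
    by (rule is_berk_seminorm_graded) (auto simp: s g)
  ultimately show ?thesis by simp
qed

section \<open>The Gauss norm as a supremum over the unit polydisc\<close>

text \<open>More points than the degree, in pairwise distinct residue classes of the unit disc, bound the
  coefficients of a polynomial by its values at these points: splitting off one point \<open>u\<close> writes
  \<open>p = (X - u) q + p(u)\<close>, and division by the differences, which have absolute value 1, shows that
  \<open>q\<close> satisfies the same bound at the other points.\<close>

lemma nabs_coeff_le_if_nabs_poly_le:
  fixes p :: "'c::complete_nonarch_field poly"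
  assumes "finite U" "degree p < card U" "0 \<le> B"
    and "\<And>u. u \<in> U \<Longrightarrow> nabs u \<le> 1"
    and "\<And>u v. u \<in> U \<Longrightarrow> v \<in> U \<Longrightarrow> u \<noteq> v \<Longrightarrow> nabs (u - v) = 1"
    and "\<And>u. u \<in> U \<Longrightarrow> nabs (poly p u) \<le> B"
  shows "nabs (coeff p e) \<le> B"
  using assms
proof (induction "card U" arbitrary: U p e)
  case 0
  then show ?case by simp
next
  case (Suc n)
  then obtain u where u: "u \<in> U" by (metis card_gt_0_iff ex_in_conv zero_less_Suc)
  define q where "q = synthetic_div p u"
  have p: "p = [:- u, 1:] * q + [:poly p u:]"
    unfolding q_def using synthetic_div_correct'[of u p] by simp
  have q: "nabs (coeff q e) \<le> B" for e
  proof (cases "degree p = 0")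
    case True
    then show ?thesis using Suc.prems by (simp add: q_def synthetic_div_eq_0_iff[THEN iffD2])
  next
    case False
    show ?thesis
    proof (rule Suc.hyps(1)[of "U - {u}"])
      show "n = card (U - {u})" using Suc.hyps Suc.prems u by simp
      show "degree q < card (U - {u})" using Suc.prems u False by (simp add: q_def degree_synthetic_div)
      fix v assume v: "v \<in> U - {u}"
      have "poly p v - poly p u = (v - u) * poly q v"
        by (subst (1) p) (simp add: algebra_simps)
      moreover have "nabs (v - u) = 1" using Suc.prems u v by auto
      ultimately have "nabs (poly q v) = nabs (poly p v - poly p u)"
        by (simp add: nabs_mult)
      also have "\<dots> \<le> B" using Suc.prems u v by (intro nabs_diff_le) auto
      finally show "nabs (poly q v) \<le> B" .
    qed (use Suc.prems in auto)
  qed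
  have uq: "nabs (u * coeff q e) \<le> B" for e
    using q[of e] Suc.prems(4)[OF u] Suc.prems(3) mult_mono[of "nabs u" 1 "nabs (coeff q e)" B]
    by (simp add: nabs_mult)
  show ?case
  proof (cases e)
    case 0
    have "coeff p e = poly p u - u * coeff q 0" by (subst (1) p) (simp add: 0)
    then show ?thesis using uq[of 0] Suc.prems(6)[OF u] by (simp add: nabs_diff_le)
  next
    case (Suc e')
    have "coeff p e = coeff q e' - u * coeff q e" by (subst (1) p) (simp add: Suc)
    then show ?thesis using uq[of e] q[of e'] by (simp add: nabs_diff_le)
  qed
qed

lemma completed_alg_closureD:
  assumes "completed_alg_closure j"
  shows "j 1 = 1" "j 0 = 0" "j (x + y) = j x + j y" "j (x * y) = j x * j y" "j (- x) = - j x"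
    "j (x - y) = j x - j y" "nabs (j (to_ac a)) = nabs a"
proof -
  have h: "j 1 = 1" "\<And>x y. j (x + y) = j x + j y" "\<And>x y. j (x * y) = j x * j y"
    "\<And>a. nabs (j (to_ac a)) = nabs a"
    using assms by (auto simp: completed_alg_closure_def)
  show 0: "j 0 = 0" using h(2)[of 0 0] by (metis add_0_right add_left_imp_eq)
  have m: "j (- x) = - j x" for x
    using h(2)[of x "- x"] 0 by (simp add: eq_neg_iff_add_eq_0 add.commute)
  show "j (- x) = - j x" by (rule m)
  show "j (x - y) = j x - j y" using h(2)[of x "- y"] m[of y] by simp
qed (use assms in \<open>auto simp: completed_alg_closure_def\<close>)

lemma nabs_prod: "nabs (\<Prod>i\<in>A. f i) = (\<Prod>i\<in>A. nabs (f i))"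
  by (induction A rule: infinite_finite_induct) (simp_all add: nabs_mult)

lemma nabs_power: "nabs (x ^ n) = nabs x ^ n"
  by (induction n) (simp_all add: nabs_mult)

lemma nabs_sum_le: "0 \<le> B \<Longrightarrow> (\<And>x. x \<in> A \<Longrightarrow> nabs (f x) \<le> B) \<Longrightarrow> nabs (sum f A) \<le> B"
  by (induction A rule: infinite_finite_induct) (auto intro: nabs_add_le)

lemma nabs_add_dominant: "nabs y < nabs x \<Longrightarrow> nabs (x + y) = nabs x"
  using nabs_add_max[of x y] nabs_diff_max[of "x + y" y] by (auto simp: max_def split: if_splits)

text \<open>The residue field of the completed algebraic closure is infinite. Given finitely many points
  \<open>v\<close> of the unit disc in pairwise distinct residue classes, a root \<open>x\<close> of \<open>(\<Prod>v. X - v) - 1\<close>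
  lies in a new class: the factors \<open>x - v\<close> have product 1, so \<open>x\<close> lies in the unit disc, and then
  each factor has absolute value exactly 1.\<close>

lemma ex_residually_distinct:
  fixes j :: "'k::complete_nonarch_field alg_closure \<Rightarrow> 'c::complete_nonarch_field"
  assumes j: "completed_alg_closure j"
  shows "\<exists>U \<subseteq> range j. finite U \<and> card U = n \<and> (\<forall>u\<in>U. nabs u \<le> 1) \<and>
    (\<forall>u\<in>U. \<forall>v\<in>U. u \<noteq> v \<longrightarrow> nabs (u - v) = 1)"
proof (induction n)
  case 0
  show ?case by (rule exI[of _ "{}"]) simp
next
  case (Suc n)
  then obtain U where U: "U \<subseteq> range j" "finite U" "card U = n" "\<forall>u\<in>U. nabs u \<le> 1"
    "\<forall>u\<in>U. \<forall>v\<in>U. u \<noteq> v \<longrightarrow> nabs (u - v) = 1"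
    by (elim exE conjE) (rule that)
  show ?case
  proof (cases "U = {}")
    case True
    then show ?thesis using U completed_alg_closureD(2)[OF j]
      by (intro exI[of _ "{0}"]) (auto intro: range_eqI[of _ _ 0])
  next
    case False
    obtain V where V': "U = j ` V" "inj_on j V"
      using U(1) unfolding subset_image_inj by blast
    have V: "finite V" "U = j ` V" "inj_on j V"
      using V' U(2) by (auto dest: finite_imageD)
    define p where "p = (\<Prod>v\<in>V. [:- v, 1:]) - 1"
    have dq: "degree (\<Prod>v\<in>V. [:- v, 1:]) = card V"
      by (subst degree_prod_eq_sum_degree) auto
    have V0: "card V > 0" using V False by (auto simp: card_gt_0_iff)
    have "degree p > 0"
      using dq V0 degree_add_eq_left[of "- 1" "\<Prod>v\<in>V. [:- v, 1:]"] by (simp add: p_def)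
    then obtain x where "poly p x = 0" using alg_closed_imp_poly_has_root by blast
    then have x: "(\<Prod>v\<in>V. x - v) = 1" by (simp add: p_def poly_prod)
    have jprod: "j (\<Prod>v\<in>W. f v) = (\<Prod>v\<in>W. j (f v))" for f :: "'k alg_closure \<Rightarrow> 'k alg_closure" and W
      by (induction W rule: infinite_finite_induct) (simp_all add: completed_alg_closureD[OF j])
    have prod1: "(\<Prod>v\<in>V. nabs (j x - j v)) = 1"
      using arg_cong[OF x, of "\<lambda>y. nabs (j y)"]
      by (simp add: jprod nabs_prod completed_alg_closureD[OF j])
    have jx: "nabs (j x) \<le> 1"
    proof (rule ccontr)
      assume n: "\<not> nabs (j x) \<le> 1"
      have "nabs (j x - j v) > 1" if "v \<in> V" for v
      proof -
        have "nabs (- j v) < nabs (j x)" using U(4) V(2) that n by fastforce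
        from nabs_add_dominant[OF this] n show ?thesis by simp
      qed
      then have "1 < (\<Prod>v\<in>V. nabs (j x - j v))"
        using V V0 by (intro less_1_prod) auto
      with prod1 show False by simp
    qed
    have le: "nabs (j x - j v) \<le> 1" if "v \<in> V" for v
      using jx U(4) V(2) that by (intro nabs_diff_le) auto
    have d: "nabs (j x - j v) = 1" if v: "v \<in> V" for v
    proof -
      have "1 = nabs (j x - j v) * (\<Prod>w\<in>V - {v}. nabs (j x - j w))"
        using prod.remove[OF V(1) v, of "\<lambda>w. nabs (j x - j w)"] prod1 by simp
      also have "\<dots> \<le> nabs (j x - j v) * 1"
        using le by (intro mult_left_mono prod_le_1) auto
      finally show ?thesis using le[OF v] by simp
    qed
    then have "j x \<notin> U" using V(2) by force
    moreover have "nabs (j v - j x) = 1" if "v \<in> V" for v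
      using d[OF that] nabs_minus[of "j x - j v"] by simp
    ultimately show ?thesis
      using U V(2) jx d by (intro exI[of _ "insert (j x) U"]) auto
  qed
qed

lemma ex_nabs_coeff_le_nabs_poly:
  fixes p :: "'c::complete_nonarch_field poly"
  assumes j: "completed_alg_closure (j :: 'k::complete_nonarch_field alg_closure \<Rightarrow> 'c)"
  shows "\<exists>u. nabs u \<le> 1 \<and> nabs (coeff p e) \<le> nabs (poly p u)"
proof -
  obtain U :: "'c set" where U: "finite U" "card U = degree p + 1" "\<forall>u\<in>U. nabs u \<le> 1"
    "\<forall>u\<in>U. \<forall>v\<in>U. u \<noteq> v \<longrightarrow> nabs (u - v) = 1"
    using ex_residually_distinct[OF j, of "degree p + 1"] by (elim exE conjE) (rule that)
  define B where "B = Max ((\<lambda>u. nabs (poly p u)) ` U)"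
  have ne: "U \<noteq> {}" using U by auto
  have "B \<in> (\<lambda>u. nabs (poly p u)) ` U" unfolding B_def using U ne by (intro Max_in) auto
  then obtain u where u: "u \<in> U" "B = nabs (poly p u)" by auto
  have "nabs (poly p v) \<le> B" if "v \<in> U" for v
    unfolding B_def using U(1) that by (intro Max_ge) auto
  moreover have "0 \<le> B" by (simp add: u(2))
  ultimately have "nabs (coeff p e) \<le> B"
    using U by (intro nabs_coeff_le_if_nabs_poly_le[of U]) auto
  with u U show ?thesis by auto
qed

text \<open>The maximum principle in several variables, one variable at a time. The variables in \<open>S\<close> have
  already been given good values; of the terms of the polynomial, only those sharing with \<open>m0\<close> the
  exponents of the remaining variables are kept. Adding a variable \<open>k\<close> to \<open>S\<close> readmits terms with
  other exponents of \<open>k\<close>; the old slice is one coefficient of the resulting polynomial in the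
  \<open>k\<close>-th coordinate, and the one-variable case supplies a value of that coordinate at which the
  polynomial is at least as large as this coefficient.\<close>

lemma ex_nabs_coeff_le_nabs_eval_slice:
  fixes a :: "('n::finite \<Rightarrow>\<^sub>0 nat) \<Rightarrow> 'c::complete_nonarch_field"
  assumes j: "completed_alg_closure (j :: 'k::complete_nonarch_field alg_closure \<Rightarrow> 'c)"
    and M: "finite M" "m0 \<in> M"
  shows "\<exists>b. (\<forall>i. nabs (b i) \<le> 1) \<and> nabs (a m0) \<le> nabs
    (\<Sum>m\<in>{m \<in> M. \<forall>i\<in>-S. Poly_Mapping.lookup m i = Poly_Mapping.lookup m0 i}.
       a m * (\<Prod>i\<in>UNIV. b i ^ Poly_Mapping.lookup m i))"
proof (induction S rule: infinite_finite_induct)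
  case (infinite S)
  then show ?case by simp
next
  case empty
  have "{m \<in> M. \<forall>i\<in>-{}. Poly_Mapping.lookup m i = Poly_Mapping.lookup m0 i} = {m0}"
    using M by (auto intro: poly_mapping_eqI)
  then show ?case by (intro exI[of _ "\<lambda>_. 1"]) (simp only:, simp)
next
  case (insert k S)
  let ?M = "\<lambda>S. {m \<in> M. \<forall>i\<in>-S. Poly_Mapping.lookup m i = Poly_Mapping.lookup m0 i}"
  obtain b where b: "\<And>i. nabs (b i) \<le> 1"
    "nabs (a m0) \<le> nabs (\<Sum>m\<in>?M S. a m * (\<Prod>i\<in>UNIV. b i ^ Poly_Mapping.lookup m i))"
    using insert.IH by blast
  \<comment> \<open>The polynomial in the \<open>k\<close>-th coordinate obtained by fixing the others at \<open>b\<close>.\<close>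
  define A where "A m = a m * (\<Prod>i\<in>UNIV - {k}. b i ^ Poly_Mapping.lookup m i)" for m
  define p where "p = (\<Sum>m\<in>?M (insert k S). monom (A m) (Poly_Mapping.lookup m k))"
  have A: "a m * (\<Prod>i\<in>UNIV. (b(k := u)) i ^ Poly_Mapping.lookup m i) = A m * u ^ Poly_Mapping.lookup m k"
    for m u
    by (subst prod.remove[of _ k]) (auto simp: A_def intro!: prod.cong)
  have pu: "poly p u = (\<Sum>m\<in>?M (insert k S). a m * (\<Prod>i\<in>UNIV. (b(k := u)) i ^ Poly_Mapping.lookup m i))" for u
    unfolding A by (simp add: p_def poly_sum poly_monom)
  let ?e = "Poly_Mapping.lookup m0 k"
  have "coeff p ?e = (\<Sum>m\<in>?M (insert k S). if Poly_Mapping.lookup m k = ?e then A m else 0)"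
    by (simp add: p_def coeff_sum)
  also have "\<dots> = (\<Sum>m\<in>{m \<in> ?M (insert k S). Poly_Mapping.lookup m k = ?e}. A m)"
    using M(1) by (subst sum.inter_filter) auto
  also have "{m \<in> ?M (insert k S). Poly_Mapping.lookup m k = ?e} = ?M S"
    using insert.hyps by auto
  finally have coeff: "coeff p ?e = (\<Sum>m\<in>?M S. A m)" .
  have "(\<Sum>m\<in>?M S. a m * (\<Prod>i\<in>UNIV. b i ^ Poly_Mapping.lookup m i)) = coeff p ?e * b k ^ ?e"
    unfolding coeff sum_distrib_right
    by (rule sum.cong) (use A[of _ "b k"] insert.hyps in auto)
  then have "nabs (a m0) \<le> nabs (coeff p ?e) * nabs (b k) ^ ?e"
    using b(2) by (simp add: nabs_mult nabs_power)
  also have "\<dots> \<le> nabs (coeff p ?e)"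
    using b(1)[of k] by (simp add: mult_left_le power_le_one)
  finally have "nabs (a m0) \<le> nabs (coeff p ?e)" .
  moreover obtain u where u: "nabs u \<le> 1" "nabs (coeff p ?e) \<le> nabs (poly p u)"
    using ex_nabs_coeff_le_nabs_poly[OF j] by blast
  ultimately have "nabs (a m0) \<le> nabs (poly p u)" by simp
  moreover have "\<forall>i. nabs ((b(k := u)) i) \<le> 1" using b(1) u(1) by simp
  ultimately show ?case unfolding pu by blast
qed

lemma nabs_eval_le_gauss_norm:
  assumes "\<And>x. nabs (h x) = nabs x" "\<And>i. nabs (b i) \<le> 1"
  shows "nabs (eval_mpol h b f) \<le> gauss_norm f"
  unfolding eval_mpol_def
proof (rule nabs_sum_le[OF gauss_norm_nonneg])
  fix m
  have "nabs (\<Prod>i\<in>UNIV. b i ^ Poly_Mapping.lookup m i) \<le> 1"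
    unfolding nabs_prod nabs_power using assms by (intro prod_le_1) (auto simp: power_le_one)
  then show "nabs (h (Poly_Mapping.lookup f m) * (\<Prod>i\<in>UNIV. b i ^ Poly_Mapping.lookup m i)) \<le> gauss_norm f"
    using nabs_coeff_le_gauss_norm[of f m] mult_left_le[of _ "nabs (Poly_Mapping.lookup f m)"]
    unfolding nabs_mult assms(1) by (meson nabs_nonneg order_trans)
qed

proposition SUP_nabs_eval_eq_gauss_norm:
  fixes j :: "'k::complete_nonarch_field alg_closure \<Rightarrow> 'c::complete_nonarch_field"
    and f :: "('n::finite, 'k) mpol"
  assumes j: "completed_alg_closure j"
  shows "(SUP b\<in>{b. \<forall>n. nabs (b n) \<le> 1}. nabs (eval_mpol (\<lambda>a. j (to_ac a)) b f)) = gauss_norm f"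
proof (rule cSup_eq_maximum)
  let ?h = "\<lambda>a. j (to_ac a)"
  have le: "nabs (eval_mpol ?h b f) \<le> gauss_norm f" if "\<forall>n. nabs (b n) \<le> 1" for b
    using that completed_alg_closureD(7)[OF j] by (intro nabs_eval_le_gauss_norm) auto
  have "\<exists>b. (\<forall>n. nabs (b n) \<le> 1) \<and> gauss_norm f \<le> nabs (eval_mpol ?h b f)"
  proof (cases "f = 0")
    case True
    then show ?thesis by (intro exI[of _ "\<lambda>_. 1"]) auto
  next
    case False
    then obtain m where m: "m \<in> Poly_Mapping.keys f" "nabs (Poly_Mapping.lookup f m) = gauss_norm f"
      by (rule gauss_norm_attained)
    have "\<exists>b. (\<forall>i. nabs (b i) \<le> 1) \<and> nabs (?h (Poly_Mapping.lookup f m)) \<le> nabs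
      (\<Sum>m\<in>{m' \<in> Poly_Mapping.keys f. \<forall>i\<in>-UNIV. Poly_Mapping.lookup m' i = Poly_Mapping.lookup m i}.
         ?h (Poly_Mapping.lookup f m) * (\<Prod>i\<in>UNIV. b i ^ Poly_Mapping.lookup m i))"
      by (rule ex_nabs_coeff_le_nabs_eval_slice[OF j]) (use m in auto)
    then show ?thesis
      using m(2) completed_alg_closureD(7)[OF j] by (simp add: eval_mpol_def)
  qed
  then obtain b where "\<forall>n. nabs (b n) \<le> 1" "gauss_norm f \<le> nabs (eval_mpol ?h b f)" by blast
  with le[of b] show "gauss_norm f \<in> (\<lambda>b. nabs (eval_mpol ?h b f)) ` {b. \<forall>n. nabs (b n) \<le> 1}"
    by (intro image_eqI[of _ _ b] antisym) auto
  show "x \<le> gauss_norm f" if "x \<in> (\<lambda>b. nabs (eval_mpol ?h b f)) ` {b. \<forall>n. nabs (b n) \<le> 1}" for x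
    using that le by auto
qed

lemma berk_affine_eqI: "(\<And>f. berk_seminorm \<zeta> f = berk_seminorm \<xi> f) \<Longrightarrow> \<zeta> = \<xi>"
  by (simp add: berk_seminorm_inject[symmetric] ext)

lemma berk_seminorm_gauss_affine:
  fixes j :: "'k::complete_nonarch_field alg_closure \<Rightarrow> 'c::complete_nonarch_field"
  assumes "completed_alg_closure j"
  shows "berk_seminorm (gauss_affine j :: ('n::finite, 'k) berk_affine) = gauss_norm"
proof -
  let ?G = "Abs_berk_affine gauss_norm :: ('n, 'k) berk_affine"
  have G: "berk_seminorm ?G = gauss_norm"
    by (simp add: Abs_berk_affine_inverse is_berk_seminorm_gauss_norm)
  have "gauss_affine j = ?G"
    unfolding gauss_affine_def SUP_nabs_eval_eq_gauss_norm[OF assms]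
    by (rule the_equality) (auto simp: G intro: berk_affine_eqI)
  with G show ?thesis by simp
qed

section \<open>Dilation and normalized representatives\<close>

definition mono_degree :: "('n::finite \<Rightarrow>\<^sub>0 nat) \<Rightarrow> nat" where
  "mono_degree m = (\<Sum>i\<in>UNIV. Poly_Mapping.lookup m i)"

lemma mono_degree_0 [simp]: "mono_degree 0 = 0"
  by (simp add: mono_degree_def)

lemma mono_degree_add: "mono_degree (m + m') = mono_degree m + mono_degree m'"
  by (simp add: mono_degree_def Poly_Mapping.lookup_add sum.distrib)

lemma homogeneous_mpol_iff: "homogeneous_mpol d f \<longleftrightarrow> Poly_Mapping.keys f \<subseteq> mono_degree -` {d}"
  by (auto simp: homogeneous_mpol_def mono_degree_def)

lemma homogeneous_mpol_var: "homogeneous_mpol 1 (mpol_var i :: ('n::finite, 'a::zero_neq_one) mpol)"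
proof -
  have "(\<Sum>k\<in>UNIV. Poly_Mapping.lookup (Poly_Mapping.single i (1::nat)) k) = 1"
    by (simp add: Poly_Mapping.lookup_single when_def)
  then show ?thesis by (auto simp: homogeneous_mpol_def mpol_var_def)
qed

abbreviation homogeneous_component :: "nat \<Rightarrow> ('n::finite, 'a::zero) mpol \<Rightarrow> ('n, 'a) mpol" where
  "homogeneous_component d \<equiv> mpol_part (mono_degree -` {d})"

lemma homogeneous_component_homogeneous:
  assumes "homogeneous_mpol d f"
  shows "homogeneous_component e f = (if e = d then f else 0)"
  using assms by (auto simp: homogeneous_mpol_iff intro!: mpol_part_id mpol_part_eq_0)

lemma homogeneous_mpol_component: "homogeneous_mpol d (homogeneous_component d f)"
  by (simp add: homogeneous_mpol_iff keys_mpol_part)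

lemma is_berk_seminorm_berk_seminorm [simp]: "is_berk_seminorm (berk_seminorm \<zeta>)"
  using berk_seminorm[of \<zeta>] by simp

text \<open>For \<open>c > 0\<close>, another representative of the same point of projective space. The factor \<open>c\<close> need not be an
  absolute value of the field, so scaling the coordinates would not suffice. For \<open>c = 1\<close> the result
  may still differ from \<open>\<zeta>\<close>: it is the largest seminorm that agrees with \<open>\<zeta>\<close> on homogeneous
  polynomials.\<close>

definition dilate :: "real \<Rightarrow> ('n::finite, 'a::complete_nonarch_field) berk_affine \<Rightarrow> ('n, 'a) berk_affine"
  where "dilate c \<zeta> = Abs_berk_affine (graded_seminorm (\<lambda>d. c ^ d) mono_degree (berk_seminorm \<zeta>))"

lemma berk_seminorm_dilate:
  "c > 0 \<Longrightarrow> berk_seminorm (dilate c \<zeta>) = graded_seminorm (\<lambda>d. c ^ d) mono_degree (berk_seminorm \<zeta>)"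
  unfolding dilate_def
  by (rule Abs_berk_affine_inverse)
    (auto intro!: is_berk_seminorm_graded simp: mono_degree_add power_add)

lemma berk_seminorm_dilate_homogeneous:
  assumes "c > 0" "homogeneous_mpol d f"
  shows "berk_seminorm (dilate c \<zeta>) f = c ^ d * berk_seminorm \<zeta> f"
proof (rule antisym)
  note s0 = berk_seminorm_0[OF is_berk_seminorm_berk_seminorm]
  have nn: "0 \<le> c ^ d * berk_seminorm \<zeta> f"
    using assms(1) berk_seminormD(1)[of "berk_seminorm \<zeta>" f] by simp
  then show "berk_seminorm (dilate c \<zeta>) f \<le> c ^ d * berk_seminorm \<zeta> f"
    unfolding berk_seminorm_dilate[OF assms(1)]
    by (rule graded_seminorm_le) (auto simp: homogeneous_component_homogeneous[OF assms(2)] s0 nn)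
  show "c ^ d * berk_seminorm \<zeta> f \<le> berk_seminorm (dilate c \<zeta>) f"
    using graded_seminorm_ge[of "berk_seminorm \<zeta>" "\<lambda>d. c ^ d" d mono_degree f]
    by (simp add: berk_seminorm_dilate[OF assms(1)] homogeneous_component_homogeneous[OF assms(2)] s0)
qed

lemma berk_seminorm_var_le_norm: "berk_seminorm \<zeta> (mpol_var i) \<le> berk_norm \<zeta>"
  unfolding berk_norm_def by (rule Max_ge) auto

lemma berk_norm_attained: "\<exists>i. berk_norm \<zeta> = berk_seminorm \<zeta> (mpol_var i)"
proof -
  have "berk_norm \<zeta> \<in> range (\<lambda>i. berk_seminorm \<zeta> (mpol_var i))"
    unfolding berk_norm_def by (rule Max_in) auto
  then show ?thesis by auto
qed

lemma berk_norm_eq_1_iff: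
  "berk_norm \<zeta> = 1 \<longleftrightarrow>
    (\<forall>i. berk_seminorm \<zeta> (mpol_var i) \<le> 1) \<and> (\<exists>i. berk_seminorm \<zeta> (mpol_var i) = 1)"
  by (metis berk_norm_attained berk_seminorm_var_le_norm order_antisym)

lemma berk_norm_nonneg: "0 \<le> berk_norm \<zeta>"
  using berk_norm_attained[of \<zeta>] berk_seminormD(1)[OF is_berk_seminorm_berk_seminorm] by metis

lemma mpol_var_power: "mpol_var i ^ k = (Poly_Mapping.single (Poly_Mapping.single i k) 1 :: ('n, 'a::comm_ring_1) mpol)"
  by (induction k) (simp_all add: mpol_var_def Poly_Mapping.mult_single flip: Poly_Mapping.single_add)

lemma single_eq_const_mult_vars:
  "Poly_Mapping.single m c =
    mpol_const c * (\<Prod>i\<in>UNIV. mpol_var i ^ Poly_Mapping.lookup m i :: ('n::finite, 'a::comm_ring_1) mpol)"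
proof -
  have "(\<Prod>i\<in>A. mpol_var i ^ Poly_Mapping.lookup m i :: ('n, 'a) mpol) =
      Poly_Mapping.single (\<Sum>i\<in>A. Poly_Mapping.single i (Poly_Mapping.lookup m i)) 1" for A
    by (induction A rule: infinite_finite_induct)
      (simp_all add: mpol_var_power Poly_Mapping.mult_single)
  moreover have "(\<Sum>i\<in>UNIV. Poly_Mapping.single i (Poly_Mapping.lookup m i)) = m"
    by (rule poly_mapping_eqI) (simp add: Poly_Mapping.lookup_sum Poly_Mapping.lookup_single when_def)
  ultimately show ?thesis by (simp add: mpol_const_def Poly_Mapping.mult_single)
qed

lemma berk_seminorm_power:
  "is_berk_seminorm s \<Longrightarrow> s (f ^ k) = s f ^ k"
  by (induction k) (simp_all add: berk_seminorm_1 berk_seminormD(4))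

lemma berk_seminorm_single:
  assumes s: "is_berk_seminorm s"
  shows "s (Poly_Mapping.single m c) = nabs c * (\<Prod>i\<in>UNIV. s (mpol_var i) ^ Poly_Mapping.lookup m i)"
proof -
  have "s (\<Prod>i\<in>A. F i) = (\<Prod>i\<in>A. s (F i))" for F and A :: "'a set"
    by (induction A rule: infinite_finite_induct)
      (simp_all add: berk_seminorm_1[OF s] berk_seminormD(4)[OF s])
  then show ?thesis
    unfolding single_eq_const_mult_vars[of m c]
    by (simp add: berk_seminormD(2,4)[OF s] berk_seminorm_power[OF s])
qed

text \<open>The Gauss norm is the largest seminorm on the closed unit polydisc.\<close>

lemma berk_seminorm_le_gauss_norm:
  assumes s: "is_berk_seminorm s" and le: "\<And>i. s (mpol_var i) \<le> 1"
  shows "s f \<le> gauss_norm f"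
proof -
  have "s (Poly_Mapping.single m (Poly_Mapping.lookup f m)) \<le> gauss_norm f" for m
  proof -
    have "(\<Prod>i\<in>UNIV. s (mpol_var i) ^ Poly_Mapping.lookup m i) \<le> 1"
      using le berk_seminormD(1)[OF s] by (intro prod_le_1) (auto simp: power_le_one)
    then show ?thesis
      using nabs_coeff_le_gauss_norm[of f m] mult_left_le[of _ "nabs (Poly_Mapping.lookup f m)"]
      unfolding berk_seminorm_single[OF s] by (meson nabs_nonneg order_trans)
  qed
  then show ?thesis
    by (subst mpol_sum_single) (intro berk_seminorm_sum_le[OF s] gauss_norm_nonneg)
qed

text \<open>A seminorm that kills the indeterminates does not see the terms of positive degree; so the origin
  is the only point of norm 0.\<close>

lemma berk_seminorm_eq_constant_term:
  assumes s: "is_berk_seminorm s" and 0: "\<And>i. s (mpol_var i) = 0"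
  shows "s f = nabs (Poly_Mapping.lookup f 0)"
proof -
  let ?c = "mpol_const (Poly_Mapping.lookup f 0)"
  have f: "f = ?c + mpol_part (- {0}) f"
    by (rule poly_mapping_eqI)
      (auto simp: Poly_Mapping.lookup_add mpol_part.rep_eq mpol_const_def Poly_Mapping.lookup_single when_def)
  have sing: "s (Poly_Mapping.single m c) = 0" if m: "m \<noteq> 0" for m c
  proof -
    obtain i where "Poly_Mapping.lookup m i \<noteq> 0"
      using m by (metis lookup_zero poly_mapping_eqI)
    then have "(\<Prod>i\<in>UNIV. s (mpol_var i) ^ Poly_Mapping.lookup m i) = 0"
      by (intro prod_zero) (auto simp: 0)
    then show ?thesis by (simp add: berk_seminorm_single[OF s])
  qed
  have "s (mpol_part (- {0}) f) \<le> 0"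
    by (subst mpol_sum_single) (intro berk_seminorm_sum_le[OF s], auto simp: keys_mpol_part sing)
  then have r: "s (mpol_part (- {0}) f) = 0"
    using berk_seminormD(1)[OF s] by (simp add: antisym)
  have "s f \<le> nabs (Poly_Mapping.lookup f 0)"
    using berk_seminormD(3)[OF s, of ?c "mpol_part (- {0}) f"] f r
    by (simp add: berk_seminormD(2)[OF s])
  moreover have "nabs (Poly_Mapping.lookup f 0) \<le> s f"
  proof -
    have "?c = f - mpol_part (- {0}) f" using f by (simp add: eq_diff_eq)
    then show ?thesis
      using berk_seminorm_diff[OF s, of f "mpol_part (- {0}) f"] r berk_seminormD(1)[OF s, of f]
        berk_seminormD(2)[OF s, of "Poly_Mapping.lookup f 0"] by simp
  qed
  ultimately show ?thesis by (rule antisym)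
qed

lemma berk_seminorm_origin_var:
  "berk_seminorm berk_origin (mpol_var i :: ('n::finite, 'a::complete_nonarch_field) mpol) = 0"
proof -
  have "(\<Prod>j\<in>UNIV. (0::'a) ^ Poly_Mapping.lookup (Poly_Mapping.single i (1::nat)) j) = 0"
    by (rule prod_zero[OF finite]) (auto intro!: exI[of _ i])
  then show ?thesis
    by (simp add: berk_origin_def Abs_berk_affine_inverse is_berk_seminorm_eval mpol_var_def
        eval_mpol_single)
qed

lemma berk_norm_eq_0_iff: "berk_norm \<zeta> = 0 \<longleftrightarrow> \<zeta> = berk_origin"
proof
  assume "\<zeta> = berk_origin"
  then show "berk_norm \<zeta> = 0"
    using berk_norm_attained[of \<zeta>] by (simp add: berk_seminorm_origin_var)
next
  assume "berk_norm \<zeta> = 0"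
  then have "berk_seminorm \<zeta> (mpol_var i) = 0" for i
    using berk_seminorm_var_le_norm[of \<zeta> i] berk_seminormD(1)[of "berk_seminorm \<zeta>" "mpol_var i"] by simp
  then show "\<zeta> = berk_origin"
    by (intro berk_affine_eqI) (simp add: berk_seminorm_eq_constant_term berk_seminorm_origin_var)
qed

lemma berk_pi_eqI:
  assumes "berk_proj_rel \<zeta> \<xi>" shows "berk_pi \<zeta> = berk_pi \<xi>"
  unfolding berk_pi_def
  using assms Quotient_rel_abs[OF Quotient_berk_proj] by blast

text \<open>Dilating any representative by the inverse of its norm stays in its class, since dilation
  multiplies homogeneous polynomials of degree \<open>d\<close> by the \<open>d\<close>-th power of the factor.\<close>

lemma ex_normalized_representative:
  "\<exists>\<zeta>. \<zeta> \<noteq> berk_origin \<and> berk_pi \<zeta> = z \<and> berk_norm \<zeta> = 1"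
proof -
  let ?\<xi> = "rep_berk_proj z"
  have rel: "berk_proj_rel ?\<xi> ?\<xi>"
    using Quotient_rep_reflp[OF Quotient_berk_proj] .
  then have nz: "?\<xi> \<noteq> berk_origin" by (simp add: berk_proj_rel_def)
  have pi: "berk_pi ?\<xi> = z"
    unfolding berk_pi_def by (rule Quotient_abs_rep[OF Quotient_berk_proj])
  define c where "c = 1 / berk_norm ?\<xi>"
  have c: "c > 0"
    using nz berk_norm_nonneg[of ?\<xi>] berk_norm_eq_0_iff[of ?\<xi>] by (simp add: c_def)
  have v: "berk_seminorm (dilate c ?\<xi>) (mpol_var i) = berk_seminorm ?\<xi> (mpol_var i) / berk_norm ?\<xi>" for i
    using berk_seminorm_dilate_homogeneous[OF c homogeneous_mpol_var, of ?\<xi> i] by (simp add: c_def)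
  have norm: "berk_norm (dilate c ?\<xi>) = 1"
    unfolding berk_norm_eq_1_iff v
    using berk_seminorm_var_le_norm[of ?\<xi>] berk_norm_attained[of ?\<xi>] c
    by (auto simp: c_def)
  then have nz': "dilate c ?\<xi> \<noteq> berk_origin"
    using berk_norm_eq_0_iff[of "dilate c ?\<xi>"] by simp
  have "berk_proj_rel (dilate c ?\<xi>) ?\<xi>"
    unfolding berk_proj_rel_def
    using nz nz' c berk_seminorm_dilate_homogeneous[OF c] by blast
  then have "berk_pi (dilate c ?\<xi>) = z" using berk_pi_eqI pi by metis
  with norm nz' show ?thesis by blast
qed

section \<open>Compactness of the unit sphere\<close>

lemma open_berk_seminorm_vimage:
  "open U \<Longrightarrow> open {\<zeta>. berk_seminorm \<zeta> f \<in> U}"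
  unfolding open_berk_affine_def by (rule generate_topology.Basis) blast

text \<open>On the unit polydisc every polynomial is bounded by its Gauss norm, so these seminorms lie in a
  product of compact intervals. They form a closed subset, because the axioms of a seminorm are
  conditions on finitely many values at a time; Tychonoff's theorem applies.\<close>

lemma compact_bounded_seminorms:
  "compact {s :: ('n::finite, 'a::complete_nonarch_field) mpol \<Rightarrow> real.
     is_berk_seminorm s \<and> (\<forall>i. s (mpol_var i) \<le> 1) \<and> (\<exists>i. s (mpol_var i) = 1)}"
  (is "compact ?C")
proof -
  let ?P = "Pi\<^sub>E UNIV (\<lambda>f :: ('n, 'a) mpol. {0..gauss_norm f})"
  have "compact ?P"
    using compactin_PiE[of "\<lambda>_. euclidean" UNIV "\<lambda>f :: ('n, 'a) mpol. {0..gauss_norm f}"]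
    by (simp add: euclidean_product_topology)
  moreover have "closed ?C"
  proof -
    have C: "?C = {s. (\<forall>f. 0 \<le> s f)} \<inter> {s. \<forall>a. s (mpol_const a) = nabs a} \<inter>
       {s. \<forall>f g. s (f + g) \<le> max (s f) (s g)} \<inter> {s. \<forall>f g. s (f * g) = s f * s g} \<inter>
       {s. \<forall>i. s (mpol_var i) \<le> 1} \<inter> (\<Union>i. {s. s (mpol_var i) = 1})"
      by (auto simp: is_berk_seminorm_def)
    show ?thesis
      unfolding C
      by (intro closed_Int closed_Collect_all closed_Collect_le closed_Collect_eq closed_UN
          continuous_on_product_coordinates continuous_intros ballI) auto
  qed
  moreover have "?C \<inter> ?P = ?C"
  proof (intro Int_absorb2 subsetI)
    fix s assume "s \<in> ?C"
    then have "0 \<le> s f" "s f \<le> gauss_norm f" for f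
      using berk_seminormD(1)[of s f] berk_seminorm_le_gauss_norm[of s f] by auto
    then show "s \<in> ?P" by (simp add: PiE_def)
  qed
  ultimately show ?thesis
    using closed_Int_compact[of ?C ?P] by simp
qed

text \<open>The weak topology of affine space is the topology of pointwise convergence of seminorms, so the
  compact set of seminorms above maps continuously onto the sphere.\<close>

proposition compact_berk_unit_sphere:
  "compact {\<zeta> :: ('n::finite, 'a::complete_nonarch_field) berk_affine. berk_norm \<zeta> = 1}"
proof -
  define C where "C = {s :: ('n, 'a) mpol \<Rightarrow> real.
     is_berk_seminorm s \<and> (\<forall>i. s (mpol_var i) \<le> 1) \<and> (\<exists>i. s (mpol_var i) = 1)}"
  have "openin (top_of_set C) (C \<inter> Abs_berk_affine -` U)" if "open U" for U :: "('n, 'a) berk_affine set"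
    using that unfolding open_berk_affine_def
  proof (induction rule: generate_topology.induct)
    case UNIV
    then show ?case by simp
  next
    case (Int a b)
    have "openin (top_of_set C) ((C \<inter> Abs_berk_affine -` a) \<inter> (C \<inter> Abs_berk_affine -` b))"
      by (rule openin_Int[OF Int.IH])
    also have "(C \<inter> Abs_berk_affine -` a) \<inter> (C \<inter> Abs_berk_affine -` b) = C \<inter> Abs_berk_affine -` (a \<inter> b)"
      by blast
    finally show ?case .
  next
    case (UN K)
    have "openin (top_of_set C) (\<Union>k\<in>K. C \<inter> Abs_berk_affine -` k)"
      using UN by (intro openin_Union) auto
    also have "(\<Union>k\<in>K. C \<inter> Abs_berk_affine -` k) = C \<inter> Abs_berk_affine -` \<Union>K" by blast
    finally show ?case .
  next
    case (Basis S)
    then obtain f V where S: "S = {\<zeta>. berk_seminorm \<zeta> f \<in> V}" "open V" by blast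
    have "C \<inter> Abs_berk_affine -` S = C \<inter> (\<lambda>s. s f) -` V"
      by (auto simp: S C_def Abs_berk_affine_inverse)
    moreover have "open ((\<lambda>s :: ('n, 'a) mpol \<Rightarrow> real. s f) -` V)"
      using S(2) by (intro open_vimage continuous_on_product_coordinates)
    ultimately show ?case by (simp add: openin_open_Int)
  qed
  then have "continuous_on C Abs_berk_affine"
    unfolding continuous_on_open_invariant openin_open by (metis Int_commute)
  then have "compact (Abs_berk_affine ` C)"
    using compact_bounded_seminorms[where 'n = 'n and 'a = 'a, folded C_def] by (rule compact_continuous_image)
  moreover have "Abs_berk_affine ` C = {\<zeta>. berk_norm \<zeta> = 1}"
    unfolding C_def
  proof safe
    fix s :: "('n, 'a) mpol \<Rightarrow> real" and i
    assume "is_berk_seminorm s" "\<forall>i. s (mpol_var i) \<le> 1" "s (mpol_var i) = 1"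
    then show "berk_norm (Abs_berk_affine s) = 1"
      by (auto simp: berk_norm_eq_1_iff Abs_berk_affine_inverse)
  next
    fix \<zeta> :: "('n, 'a) berk_affine" assume "berk_norm \<zeta> = 1"
    then show "\<zeta> \<in> Abs_berk_affine ` {s. is_berk_seminorm s \<and> (\<forall>i. s (mpol_var i) \<le> 1) \<and> (\<exists>i. s (mpol_var i) = 1)}"
      by (intro image_eqI[of _ _ "berk_seminorm \<zeta>"])
        (auto simp: berk_norm_eq_1_iff berk_seminorm_inverse)
  qed
  ultimately show ?thesis by simp
qed

lemma continuous_on_berk_pi: "continuous_on (- {berk_origin}) berk_pi"
proof -
  have "\<exists>A. open A \<and> A \<inter> - {berk_origin} = berk_pi -` B \<inter> - {berk_origin}"
    if "open B" for B :: "('a, 'b) berk_proj set"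
  proof -
    have "berk_pi -` B \<inter> - {berk_origin} = {\<zeta> \<in> - {berk_origin}. berk_pi \<zeta> \<in> B}" by blast
    with that show ?thesis
      unfolding open_berk_proj_def openin_open by (metis Int_commute)
  qed
  then show ?thesis unfolding continuous_on_open_invariant by blast
qed

section \<open>Reduction of polynomials\<close>

lemma Quotient_residue: "residue_rel a b \<longleftrightarrow> residue_rel a a \<and> residue_rel b b \<and> residue a = residue b"
  unfolding residue_def using Quotient_rel[OF Quotient_residue_field, of a b] by blast

lemma residue_eq_iff:
  "nabs a \<le> 1 \<Longrightarrow> nabs b \<le> 1 \<Longrightarrow> residue a = residue b \<longleftrightarrow> nabs (a - b) < 1"
  using Quotient_residue[of a b] by (simp add: residue_rel_def)

lemma residue_0 [simp]: "residue 0 = 0"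
  by (simp add: residue_def zero_residue_field_def)

lemma residue_1 [simp]: "residue 1 = 1"
  by (simp add: residue_def one_residue_field_def)

lemma residue_add: "nabs a \<le> 1 \<Longrightarrow> nabs b \<le> 1 \<Longrightarrow> residue (a + b) = residue a + residue b"
  unfolding residue_def by (rule plus_residue_field.abs_eq[symmetric]) (simp_all add: residue_rel_def)

lemma residue_mult: "nabs a \<le> 1 \<Longrightarrow> nabs b \<le> 1 \<Longrightarrow> residue (a * b) = residue a * residue b"
  unfolding residue_def by (rule times_residue_field.abs_eq[symmetric]) (simp_all add: residue_rel_def)

lemma residue_surj: "\<exists>a. nabs a \<le> 1 \<and> residue a = x"
proof -
  have "residue_rel (rep_residue_field x) (rep_residue_field x)"
    by (rule Quotient_rep_reflp[OF Quotient_residue_field])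
  moreover have "residue (rep_residue_field x) = x"
    unfolding residue_def by (rule Quotient_abs_rep[OF Quotient_residue_field])
  ultimately show ?thesis unfolding residue_rel_def by blast
qed

abbreviation reduce_mpol :: "('n, 'a::complete_nonarch_field) mpol \<Rightarrow> ('n, 'a residue_field) mpol" where
  "reduce_mpol \<equiv> Poly_Mapping.map residue"

lemma lookup_reduce_mpol: "Poly_Mapping.lookup (reduce_mpol f) m = residue (Poly_Mapping.lookup f m)"
  by (simp add: Poly_Mapping.map.rep_eq when_def)

lemma gauss_norm_le_1_iff: "gauss_norm f \<le> 1 \<longleftrightarrow> (\<forall>m. nabs (Poly_Mapping.lookup f m) \<le> 1)"
  by (auto intro: gauss_norm_leI order_trans[OF nabs_coeff_le_gauss_norm])

lemma gauss_norm_less_1_iff: "gauss_norm f < 1 \<longleftrightarrow> (\<forall>m. nabs (Poly_Mapping.lookup f m) < 1)"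
  by (auto intro: gauss_norm_lessI le_less_trans[OF nabs_coeff_le_gauss_norm])

lemma reduce_mpol_eq_iff:
  assumes "gauss_norm f \<le> 1" "gauss_norm g \<le> 1"
  shows "reduce_mpol f = reduce_mpol g \<longleftrightarrow> gauss_norm (f - g) < 1"
  using assms
  by (simp add: poly_mapping_eq_iff fun_eq_iff lookup_reduce_mpol gauss_norm_less_1_iff
      gauss_norm_le_1_iff residue_eq_iff Poly_Mapping.lookup_minus)

lemma reduce_mpol_0 [simp]: "reduce_mpol 0 = 0"
  by (rule poly_mapping_eqI) (simp add: lookup_reduce_mpol)

lemma reduce_mpol_add:
  assumes "gauss_norm f \<le> 1" "gauss_norm g \<le> 1"
  shows "reduce_mpol (f + g) = reduce_mpol f + reduce_mpol g"
  using assms by (intro poly_mapping_eqI)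
    (simp add: lookup_reduce_mpol Poly_Mapping.lookup_add residue_add gauss_norm_le_1_iff)

lemmas gauss_norm_add = berk_seminormD(3)[OF is_berk_seminorm_gauss_norm]
lemmas gauss_norm_mult = berk_seminormD(4)[OF is_berk_seminorm_gauss_norm]

lemma gauss_norm_sum_le_1:
  fixes F :: "'i \<Rightarrow> ('n::finite, 'a::complete_nonarch_field) mpol"
  shows "(\<And>x. x \<in> A \<Longrightarrow> gauss_norm (F x) \<le> 1) \<Longrightarrow> gauss_norm (sum F A) \<le> 1"
  using berk_seminorm_sum_le[OF is_berk_seminorm_gauss_norm, of 1] by auto

lemma reduce_mpol_sum:
  fixes F :: "'i \<Rightarrow> ('n::finite, 'a::complete_nonarch_field) mpol"
  assumes "\<And>x. x \<in> A \<Longrightarrow> gauss_norm (F x) \<le> 1"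
  shows "reduce_mpol (sum F A) = (\<Sum>x\<in>A. reduce_mpol (F x))"
  using assms
  by (induction A rule: infinite_finite_induct) (simp_all add: reduce_mpol_add gauss_norm_sum_le_1)

lemma gauss_norm_single: "gauss_norm (Poly_Mapping.single m a) = nabs a"
proof (rule antisym)
  show "gauss_norm (Poly_Mapping.single m a) \<le> nabs a"
    by (rule gauss_norm_leI) (auto simp: Poly_Mapping.lookup_single when_def)
  show "nabs a \<le> gauss_norm (Poly_Mapping.single m a)"
    using nabs_coeff_le_gauss_norm[of "Poly_Mapping.single m a" m] by simp
qed

lemma reduce_mpol_single: "reduce_mpol (Poly_Mapping.single m a) = Poly_Mapping.single m (residue a)"
  by (rule poly_mapping_eqI) (simp add: lookup_reduce_mpol Poly_Mapping.lookup_single when_def)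

lemma reduce_mpol_mult:
  fixes f g :: "('n::finite, 'a::complete_nonarch_field) mpol"
  assumes fg: "gauss_norm f \<le> 1" "gauss_norm g \<le> 1"
  shows "reduce_mpol (f * g) = reduce_mpol f * reduce_mpol g"
proof -
  let ?F = "\<lambda>m. Poly_Mapping.single m (Poly_Mapping.lookup f m)"
  let ?G = "\<lambda>m. Poly_Mapping.single m (Poly_Mapping.lookup g m)"
  have F: "gauss_norm (?F m) \<le> 1" for m using fg by (simp add: gauss_norm_single gauss_norm_le_1_iff)
  have G: "gauss_norm (?G m) \<le> 1" for m using fg by (simp add: gauss_norm_single gauss_norm_le_1_iff)
  have FG: "gauss_norm (?F m * ?G m') \<le> 1" for m m'
    using F[of m] G[of m'] by (simp add: gauss_norm_mult gauss_norm_nonneg mult_le_one)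
  have s: "reduce_mpol (?F m * ?G m') = reduce_mpol (?F m) * reduce_mpol (?G m')" for m m'
    using fg by (simp add: Poly_Mapping.mult_single reduce_mpol_single gauss_norm_le_1_iff residue_mult)
  have "f * g = sum ?F (Poly_Mapping.keys f) * sum ?G (Poly_Mapping.keys g)"
    using mpol_sum_single[of f] mpol_sum_single[of g] by simp
  also have "\<dots> = (\<Sum>m\<in>Poly_Mapping.keys f. \<Sum>m'\<in>Poly_Mapping.keys g. ?F m * ?G m')"
    by (simp add: sum_product)
  finally have "reduce_mpol (f * g) =
      (\<Sum>m\<in>Poly_Mapping.keys f. \<Sum>m'\<in>Poly_Mapping.keys g. reduce_mpol (?F m * ?G m'))"
    by (simp only: reduce_mpol_sum FG gauss_norm_sum_le_1)
  also have "\<dots> = reduce_mpol (sum ?F (Poly_Mapping.keys f)) * reduce_mpol (sum ?G (Poly_Mapping.keys g))"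
    by (simp only: reduce_mpol_sum F G s sum_product)
  finally show ?thesis
    using mpol_sum_single[of f] mpol_sum_single[of g] by simp
qed

text \<open>The lift can be chosen with the same exponents, so a homogeneous polynomial has a homogeneous lift.\<close>

lemma reduce_mpol_surj:
  fixes p :: "('n, 'a::complete_nonarch_field residue_field) mpol"
  obtains f where "gauss_norm f \<le> 1" "reduce_mpol f = p" "Poly_Mapping.keys f = Poly_Mapping.keys p"
proof -
  define r where "r x = (if x = 0 then 0 else SOME a. nabs a \<le> 1 \<and> residue a = x)" for x :: "'a residue_field"
  have r: "nabs (r x) \<le> 1" "residue (r x) = x" for x
    using someI_ex[OF residue_surj[of x]] by (auto simp: r_def)
  have r0: "r x = 0 \<longleftrightarrow> x = 0" for x using r(2)[of x] by (auto simp: r_def)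
  let ?f = "Poly_Mapping.map r p"
  have l: "Poly_Mapping.lookup ?f m = r (Poly_Mapping.lookup p m)" for m
    by (simp add: Poly_Mapping.map.rep_eq when_def r0)
  show ?thesis
  proof (rule that)
    show "gauss_norm ?f \<le> 1" by (simp add: gauss_norm_le_1_iff l r)
    show "reduce_mpol ?f = p" by (rule poly_mapping_eqI) (simp add: lookup_reduce_mpol l r)
    show "Poly_Mapping.keys ?f = Poly_Mapping.keys p" by (auto simp: Poly_Mapping.in_keys_iff l r0)
  qed
qed

lemma reduce_mpol_part: "reduce_mpol (mpol_part A f) = mpol_part A (reduce_mpol f)"
  by (rule poly_mapping_eqI) (simp add: lookup_reduce_mpol mpol_part.rep_eq)

lemma gauss_norm_part_le: "gauss_norm (mpol_part A f) \<le> gauss_norm f"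
  by (rule gauss_norm_leI) (auto simp: mpol_part.rep_eq gauss_norm_nonneg nabs_coeff_le_gauss_norm)

section \<open>Homogeneous ideals\<close>

lemma cring_mpol_ring: "cring (mpol_ring :: ('n, 'a::comm_ring_1) mpol ring)"
  by (rule cring_from_type_algebra)

lemma ring_mpol_ring: "ring (mpol_ring :: ('n, 'a::comm_ring_1) mpol ring)"
  by (rule ring_from_type_algebra)

lemma mpol_ring_simps [simp]:
  "carrier mpol_ring = UNIV" "add mpol_ring = (+)" "monoid.mult mpol_ring = (*)" "zero mpol_ring = 0" "one mpol_ring = 1"
  by (simp_all add: ring_of_type_algebra_def)

lemma ideal_mpol_ringI:
  fixes I :: "('n, 'a::comm_ring_1) mpol set"
  assumes "0 \<in> I" "\<And>f g. f \<in> I \<Longrightarrow> g \<in> I \<Longrightarrow> f + g \<in> I" "\<And>f g. f \<in> I \<Longrightarrow> g * f \<in> I"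
  shows "ideal I mpol_ring"
proof (rule idealI[OF ring_mpol_ring])
  interpret R: cring "mpol_ring :: ('n, 'a) mpol ring" by (rule cring_mpol_ring)
  show "subgroup I (add_monoid mpol_ring)"
  proof (rule group.subgroupI[OF R.a_group])
    fix f assume f: "f \<in> I"
    have "inv\<^bsub>add_monoid mpol_ring\<^esub> f = - f"
      using R.minus_equality[of "- f" f] by (simp add: a_inv_def)
    then show "inv\<^bsub>add_monoid mpol_ring\<^esub> f \<in> I" using assms(3)[OF f, of "- 1"] by simp
  qed (use assms in auto)
qed (use assms in \<open>auto simp: mult.commute\<close>)

lemma ideal_mpol_ringD:
  fixes I :: "('n, 'a::comm_ring_1) mpol set"
  assumes "ideal I mpol_ring"
  shows "0 \<in> I" "f \<in> I \<Longrightarrow> g \<in> I \<Longrightarrow> f + g \<in> I" "f \<in> I \<Longrightarrow> g * f \<in> I"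
proof -
  interpret ideal I mpol_ring by fact
  show "0 \<in> I" using additive_subgroup.zero_closed[OF additive_subgroup_axioms] by simp
  show "f \<in> I \<Longrightarrow> g \<in> I \<Longrightarrow> f + g \<in> I"
    using additive_subgroup.a_closed[OF additive_subgroup_axioms] by simp
  show "f \<in> I \<Longrightarrow> g * f \<in> I" using I_l_closed[of f g] by simp
qed

lemma ideal_mpol_ring_sum:
  fixes I :: "('n, 'a::comm_ring_1) mpol set"
  shows "ideal I mpol_ring \<Longrightarrow> (\<And>x. x \<in> A \<Longrightarrow> F x \<in> I) \<Longrightarrow> sum F A \<in> I"
  by (induction A rule: infinite_finite_induct) (auto intro: ideal_mpol_ringD)

lemma ideal_homogeneous_part: "ideal (homogeneous_part I) mpol_ring"
  unfolding homogeneous_part_def by (rule ring.genideal_ideal[OF ring_mpol_ring]) simp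

lemma homogeneous_in_homogeneous_part: "f \<in> I \<Longrightarrow> homogeneous_mpol d f \<Longrightarrow> f \<in> homogeneous_part I"
  unfolding homogeneous_part_def using ring.genideal_self[OF ring_mpol_ring] by fastforce

lemma homogeneous_part_minimal:
  "ideal J mpol_ring \<Longrightarrow> (\<And>d f. f \<in> I \<Longrightarrow> homogeneous_mpol d f \<Longrightarrow> f \<in> J) \<Longrightarrow> homogeneous_part I \<subseteq> J"
  unfolding homogeneous_part_def by (rule ring.genideal_minimal[OF ring_mpol_ring]) auto

lemma homogeneous_part_idem: "homogeneous_part (homogeneous_part I) = homogeneous_part I"
  by (intro antisym homogeneous_part_minimal ideal_homogeneous_part)
    (auto intro: homogeneous_in_homogeneous_part)

lemma homogeneous_part_principal:
  assumes "homogeneous_mpol d f"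
  shows "homogeneous_part (genideal mpol_ring {f}) = genideal mpol_ring {f}"
proof (intro antisym homogeneous_part_minimal)
  show "genideal mpol_ring {f} \<subseteq> homogeneous_part (genideal mpol_ring {f})"
    by (rule ring.genideal_minimal[OF ring_mpol_ring ideal_homogeneous_part])
      (use assms ring.genideal_self'[OF ring_mpol_ring] in \<open>auto intro!: homogeneous_in_homogeneous_part\<close>)
qed (auto intro: ring.genideal_ideal[OF ring_mpol_ring])

lemma genideal_singleton_subset_iff:
  "ideal I mpol_ring \<Longrightarrow> genideal mpol_ring {f} \<subseteq> I \<longleftrightarrow> f \<in> I"
  using ring.genideal_minimal[OF ring_mpol_ring, of I "{f}"] ring.genideal_self'[OF ring_mpol_ring, of f]
  by auto

section \<open>The reduction map\<close>

lemma small_ideal_iff: "f \<in> small_ideal \<zeta> \<longleftrightarrow> gauss_norm f \<le> 1 \<and> berk_seminorm \<zeta> f < 1"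
  by (simp add: small_ideal_def gauss_norm_le_1_iff)

lemma berk_seminorm_le_gauss_norm_on_sphere:
  "berk_norm \<zeta> = 1 \<Longrightarrow> berk_seminorm \<zeta> f \<le> gauss_norm f"
  by (rule berk_seminorm_le_gauss_norm) (auto simp: berk_norm_eq_1_iff)

text \<open>Two lifts of the same reduction differ by a polynomial of Gauss norm less than 1, which is small at
  every point of the unit sphere. So smallness can be tested on any lift.\<close>

lemma reduce_mpol_in_iff:
  assumes "berk_norm \<zeta> = 1" "gauss_norm f \<le> 1"
  shows "reduce_mpol f \<in> reduce_mpol ` small_ideal \<zeta> \<longleftrightarrow> berk_seminorm \<zeta> f < 1"
proof
  assume "reduce_mpol f \<in> reduce_mpol ` small_ideal \<zeta>"
  then obtain g where g: "gauss_norm g \<le> 1" "berk_seminorm \<zeta> g < 1" "reduce_mpol f = reduce_mpol g"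
    by (auto simp: small_ideal_iff)
  then have "gauss_norm (f - g) < 1" using assms reduce_mpol_eq_iff by blast
  then have "berk_seminorm \<zeta> (f - g) < 1"
    using berk_seminorm_le_gauss_norm_on_sphere[OF assms(1), of "f - g"] by simp
  then show "berk_seminorm \<zeta> f < 1"
    using berk_seminormD(3)[OF is_berk_seminorm_berk_seminorm, of \<zeta> "f - g" g] g(2) by simp
qed (use assms in \<open>auto simp: small_ideal_iff\<close>)

text \<open>Each ideal axiom, and primality, is a property of the seminorm once it is tested on lifts; a
  product of two values at most 1 is less than 1 only if one of the two is.\<close>

proposition primeideal_reduce_small_ideal:
  fixes \<zeta> :: "('n::finite, 'a::complete_nonarch_field) berk_affine"
  assumes \<zeta>: "berk_norm \<zeta> = 1"
  shows "primeideal (reduce_mpol ` small_ideal \<zeta>) mpol_ring"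
proof (rule primeidealI)
  let ?s = "berk_seminorm \<zeta>" and ?I = "reduce_mpol ` small_ideal \<zeta>"
  note s = is_berk_seminorm_berk_seminorm[of \<zeta>]
  note iff = reduce_mpol_in_iff[OF \<zeta>]
  note nn = berk_seminormD(1)[OF s]
  show "ideal ?I mpol_ring"
  proof (rule ideal_mpol_ringI)
    show "0 \<in> ?I" using iff[of 0] by (simp add: berk_seminorm_0[OF s])
  next
    fix p q assume "p \<in> ?I" "q \<in> ?I"
    then obtain f g where fg: "gauss_norm f \<le> 1" "?s f < 1" "gauss_norm g \<le> 1" "?s g < 1"
      and pq: "p = reduce_mpol f" "q = reduce_mpol g" by (auto simp: small_ideal_iff)
    have "gauss_norm (f + g) \<le> 1" using gauss_norm_add[of f g] fg by simp
    moreover have "?s (f + g) < 1" using berk_seminormD(3)[OF s, of f g] fg by simp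
    ultimately show "p + q \<in> ?I" using iff[of "f + g"] fg by (simp add: pq reduce_mpol_add)
  next
    fix p q :: "('n, 'a residue_field) mpol" assume "p \<in> ?I"
    then obtain f where f: "gauss_norm f \<le> 1" "?s f < 1" "p = reduce_mpol f"
      by (auto simp: small_ideal_iff)
    obtain g where g: "gauss_norm g \<le> 1" "reduce_mpol g = q" by (rule reduce_mpol_surj)
    have gf: "gauss_norm (g * f) \<le> 1"
      using f g by (simp add: gauss_norm_mult gauss_norm_nonneg mult_le_one)
    have "?s g \<le> 1" using berk_seminorm_le_gauss_norm_on_sphere[OF \<zeta>, of g] g by simp
    then have "?s (g * f) < 1"
      using f nn mult_left_le_one_le[of "?s f" "?s g"] by (simp add: berk_seminormD(4)[OF s] le_less_trans)
    then show "q * p \<in> ?I" using iff[OF gf] f g by (simp add: reduce_mpol_mult)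
  qed
  show "cring (mpol_ring :: ('n, 'a residue_field) mpol ring)" by (rule cring_mpol_ring)
  have "reduce_mpol 1 \<notin> ?I"
    using iff[of 1] by (simp add: berk_seminorm_1[OF s] berk_seminorm_1[OF is_berk_seminorm_gauss_norm])
  then show "carrier mpol_ring \<noteq> ?I" by auto
  fix p q :: "('n, 'a residue_field) mpol"
  assume pq: "p \<otimes>\<^bsub>mpol_ring\<^esub> q \<in> ?I"
  obtain f where f: "gauss_norm f \<le> 1" "reduce_mpol f = p" by (rule reduce_mpol_surj)
  obtain g where g: "gauss_norm g \<le> 1" "reduce_mpol g = q" by (rule reduce_mpol_surj)
  have fg: "gauss_norm (f * g) \<le> 1"
    using f g by (simp add: gauss_norm_mult gauss_norm_nonneg mult_le_one)
  have "?s f * ?s g < 1"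
    using pq iff[OF fg] f g by (simp add: reduce_mpol_mult berk_seminormD(4)[OF s])
  then have "?s f < 1 \<or> ?s g < 1"
    using mult_mono[of 1 "?s f" 1 "?s g"] nn by force
  then show "p \<in> ?I \<or> q \<in> ?I" using iff[OF f(1)] iff[OF g(1)] f g by auto
qed

lemma berk_norm_dilate_1: "berk_norm \<zeta> = 1 \<Longrightarrow> berk_norm (dilate 1 \<zeta>) = 1"
  by (simp add: berk_norm_eq_1_iff berk_seminorm_dilate_homogeneous[OF _ homogeneous_mpol_var])

lemma homogeneous_reduce_mpol: "homogeneous_mpol d f \<Longrightarrow> homogeneous_mpol d (reduce_mpol f)"
  by (auto simp: homogeneous_mpol_def Poly_Mapping.in_keys_iff lookup_reduce_mpol)

text \<open>This makes the homogeneous part of the reduced small ideal prime without any argument on graded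
  prime ideals: it is itself a reduced small ideal. A polynomial is small at \<open>dilate 1 \<zeta>\<close> iff all its
  homogeneous components are small at \<open>\<zeta>\<close>.\<close>

proposition homogeneous_part_reduce_small_ideal:
  fixes \<zeta> :: "('n::finite, 'a::complete_nonarch_field) berk_affine"
  assumes \<zeta>: "berk_norm \<zeta> = 1"
  shows "homogeneous_part (reduce_mpol ` small_ideal \<zeta>) = reduce_mpol ` small_ideal (dilate 1 \<zeta>)"
proof
  note \<zeta>' = berk_norm_dilate_1[OF \<zeta>]
  show "homogeneous_part (reduce_mpol ` small_ideal \<zeta>) \<subseteq> reduce_mpol ` small_ideal (dilate 1 \<zeta>)"
  proof (rule homogeneous_part_minimal)
    show "ideal (reduce_mpol ` small_ideal (dilate 1 \<zeta>)) mpol_ring"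
      using primeideal_reduce_small_ideal[OF \<zeta>'] by (rule primeideal.axioms(1))
  next
    fix d p assume p: "p \<in> reduce_mpol ` small_ideal \<zeta>" "homogeneous_mpol d p"
    obtain f where f: "gauss_norm f \<le> 1" "reduce_mpol f = p" "Poly_Mapping.keys f = Poly_Mapping.keys p"
      by (rule reduce_mpol_surj)
    have hom: "homogeneous_mpol d f" using f p by (simp add: homogeneous_mpol_def)
    have "berk_seminorm \<zeta> f < 1" using p f reduce_mpol_in_iff[OF \<zeta> f(1)] by simp
    then have "berk_seminorm (dilate 1 \<zeta>) f < 1"
      using berk_seminorm_dilate_homogeneous[OF _ hom, of 1 \<zeta>] by simp
    then show "p \<in> reduce_mpol ` small_ideal (dilate 1 \<zeta>)"
      using f reduce_mpol_in_iff[OF \<zeta>' f(1)] by simp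
  qed
  show "reduce_mpol ` small_ideal (dilate 1 \<zeta>) \<subseteq> homogeneous_part (reduce_mpol ` small_ideal \<zeta>)"
  proof
    fix p assume "p \<in> reduce_mpol ` small_ideal (dilate 1 \<zeta>)"
    then obtain f where f: "gauss_norm f \<le> 1" "berk_seminorm (dilate 1 \<zeta>) f < 1" "p = reduce_mpol f"
      by (auto simp: small_ideal_iff)
    have comp: "reduce_mpol (homogeneous_component d f) \<in> homogeneous_part (reduce_mpol ` small_ideal \<zeta>)" for d
    proof (rule homogeneous_in_homogeneous_part)
      show "homogeneous_mpol d (reduce_mpol (homogeneous_component d f))"
        by (intro homogeneous_reduce_mpol homogeneous_mpol_component)
      have "berk_seminorm \<zeta> (homogeneous_component d f) < 1"
        using f(2) graded_seminorm_ge[of "berk_seminorm \<zeta>" "\<lambda>d. 1 ^ d" d mono_degree f]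
        by (simp add: berk_seminorm_dilate berk_seminorm_0)
      moreover have "gauss_norm (homogeneous_component d f) \<le> 1"
        using f(1) gauss_norm_part_le order_trans by blast
      ultimately show "reduce_mpol (homogeneous_component d f) \<in> reduce_mpol ` small_ideal \<zeta>"
        by (auto simp: small_ideal_iff)
    qed
    have "p = (\<Sum>d\<in>mono_degree ` Poly_Mapping.keys p. homogeneous_component d p)"
      by (simp add: sum_mpol_part)
    also have "\<dots> \<in> homogeneous_part (reduce_mpol ` small_ideal \<zeta>)"
      using comp by (intro ideal_mpol_ring_sum ideal_homogeneous_part) (simp add: f(3) reduce_mpol_part)
    finally show "p \<in> homogeneous_part (reduce_mpol ` small_ideal \<zeta>)" .
  qed
qed

lemma homogeneous_part_reduce_small_ideal_in_Proj:
  fixes \<zeta> :: "('n::finite, 'a::complete_nonarch_field) berk_affine"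
  assumes \<zeta>: "berk_norm \<zeta> = 1"
  shows "homogeneous_part (reduce_mpol ` small_ideal \<zeta>) \<in> Proj"
proof -
  note \<zeta>' = berk_norm_dilate_1[OF \<zeta>]
  obtain i where i: "berk_seminorm (dilate 1 \<zeta>) (mpol_var i) = 1"
    using \<zeta>' by (auto simp: berk_norm_eq_1_iff)
  have "reduce_mpol (mpol_var i) = (mpol_var i :: ('n, 'a residue_field) mpol)"
    by (simp add: mpol_var_def reduce_mpol_single)
  then have "mpol_var i \<notin> reduce_mpol ` small_ideal (dilate 1 \<zeta>)"
    using reduce_mpol_in_iff[OF \<zeta>', of "mpol_var i"] i by simp
  then have "\<not> range mpol_var \<subseteq> reduce_mpol ` small_ideal (dilate 1 \<zeta>)" by blast
  then show ?thesis
    using primeideal_reduce_small_ideal[OF \<zeta>'] homogeneous_part_idem[of "reduce_mpol ` small_ideal \<zeta>"]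
    unfolding Proj_def homogeneous_part_reduce_small_ideal[OF \<zeta>] by auto
qed

text \<open>The generic point, obtained as the reduction of the Gauss point: a polynomial of Gauss norm less
  than 1 has reduction 0.\<close>

lemma zero_ideal_in_Proj: "{0} \<in> (Proj :: ('n::finite, 'a::complete_nonarch_field residue_field) mpol set set)"
proof -
  define \<zeta> :: "('n, 'a) berk_affine" where "\<zeta> = Abs_berk_affine gauss_norm"
  have \<zeta>: "berk_seminorm \<zeta> = gauss_norm"
    by (simp add: \<zeta>_def Abs_berk_affine_inverse is_berk_seminorm_gauss_norm)
  then have norm: "berk_norm \<zeta> = 1" by (simp add: berk_norm_eq_1_iff)
  have "reduce_mpol ` small_ideal \<zeta> \<subseteq> {0}"
  proof safe
    fix f assume "f \<in> small_ideal \<zeta>"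
    then have "gauss_norm f \<le> 1" "gauss_norm (f - 0) < 1" by (simp_all add: small_ideal_iff \<zeta>)
    then have "reduce_mpol f = reduce_mpol 0"
      by (subst reduce_mpol_eq_iff) auto
    then show "reduce_mpol f = 0" by simp
  qed
  moreover have "ideal {0 :: ('n, 'a residue_field) mpol} mpol_ring" by (rule ideal_mpol_ringI) auto
  ultimately have "homogeneous_part (reduce_mpol ` small_ideal \<zeta>) \<subseteq> {0}"
    by (intro homogeneous_part_minimal) auto
  moreover have "0 \<in> homogeneous_part (reduce_mpol ` small_ideal \<zeta>)"
    by (rule ideal_mpol_ringD(1)[OF ideal_homogeneous_part])
  ultimately have "homogeneous_part (reduce_mpol ` small_ideal \<zeta>) = {0}" by blast
  with homogeneous_part_reduce_small_ideal_in_Proj[OF norm] show ?thesis by simp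
qed

lemma Proj_closed_hypersurface:
  assumes "homogeneous_mpol d f"
  shows "Proj_closed {p \<in> Proj. f \<in> p}"
proof -
  have "{p \<in> Proj. f \<in> p} = {p \<in> Proj. genideal mpol_ring {f} \<subseteq> p}"
    using genideal_singleton_subset_iff[of _ f] primeideal.axioms(1)
    unfolding Proj_def by blast
  moreover have "ideal (genideal mpol_ring {f}) mpol_ring"
    by (rule ring.genideal_ideal[OF ring_mpol_ring]) simp
  ultimately show ?thesis
    unfolding Proj_closed_def using homogeneous_part_principal[OF assms] by blast
qed

lemma berk_reduction_representative:
  "\<exists>\<zeta>. berk_pi \<zeta> = z \<and> berk_norm \<zeta> = 1 \<and>
     berk_reduction z = homogeneous_part (reduce_mpol ` small_ideal \<zeta>)"
  using someI_ex[OF ex_normalized_representative[of z]] unfolding berk_reduction_def Let_def by blast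

section \<open>Equidistribution at the Gauss point\<close>

lemma reduce_mpol_neq_0:
  assumes "gauss_norm f = 1" shows "reduce_mpol f \<noteq> 0"
proof
  assume "reduce_mpol f = 0"
  then have "gauss_norm (f - 0) < 1"
    using reduce_mpol_eq_iff[of f 0] assms by simp
  with assms show False by simp
qed

text \<open>Only the Gauss point reduces to the generic point. If no homogeneous polynomial of Gauss norm 1 is
  small at \<open>\<zeta>\<close>, then dividing by a largest coefficient shows that \<open>\<zeta>\<close> agrees with the Gauss norm on
  all homogeneous polynomials, and these determine the point of projective space.\<close>

lemma ex_homogeneous_small_if_neq_gauss:
  fixes \<zeta> \<gamma> :: "('n::finite, 'a::complete_nonarch_field) berk_affine"
  assumes \<zeta>: "berk_norm \<zeta> = 1" and \<gamma>: "berk_seminorm \<gamma> = gauss_norm" and ne: "berk_pi \<zeta> \<noteq> berk_pi \<gamma>"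
  shows "\<exists>d f. homogeneous_mpol d f \<and> gauss_norm f = 1 \<and> berk_seminorm \<zeta> f < 1"
proof (rule ccontr)
  assume no: "\<not> ?thesis"
  have "berk_seminorm \<zeta> f = gauss_norm f" if f: "homogeneous_mpol d f" for d f
  proof (cases "f = 0")
    case True
    then show ?thesis by (simp add: berk_seminorm_0)
  next
    case False
    then obtain m where m: "m \<in> Poly_Mapping.keys f" "nabs (Poly_Mapping.lookup f m) = gauss_norm f"
      by (rule gauss_norm_attained)
    define a where "a = Poly_Mapping.lookup f m"
    have a: "a \<noteq> 0" "nabs a = gauss_norm f" using m by (auto simp: a_def Poly_Mapping.in_keys_iff)
    define g where "g = mpol_const (inverse a) * f"
    have "Poly_Mapping.keys g \<subseteq> Poly_Mapping.keys f"
      using Poly_Mapping.keys_mult[of "mpol_const (inverse a)" f]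
      by (auto simp: g_def mpol_const_def split: if_splits)
    then have "homogeneous_mpol d g" using f unfolding homogeneous_mpol_def by blast
    moreover have "gauss_norm g = 1"
      using a by (simp add: g_def gauss_norm_mult mpol_const_def gauss_norm_single nabs_inverse)
        (metis nabs_eq_0 left_inverse)
    ultimately have "1 \<le> berk_seminorm \<zeta> g" using no by force
    also have "\<dots> = berk_seminorm \<zeta> f / gauss_norm f"
      by (simp add: g_def berk_seminormD(2,4) nabs_inverse a divide_inverse mult.commute)
    finally have "gauss_norm f \<le> berk_seminorm \<zeta> f"
      using a gauss_norm_nonneg[of f] nabs_eq_0[of a] by (simp add: le_divide_eq_1 split: if_splits)
    with berk_seminorm_le_gauss_norm_on_sphere[OF \<zeta>, of f] show ?thesis by simp
  qed
  moreover have "berk_norm \<gamma> = 1" using \<gamma> by (simp add: berk_norm_eq_1_iff)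
  ultimately have "berk_proj_rel \<zeta> \<gamma>"
    unfolding berk_proj_rel_def \<gamma>
    using \<zeta> berk_norm_eq_0_iff[of \<zeta>] berk_norm_eq_0_iff[of \<gamma>] by (auto intro!: exI[of _ 1])
  with ne show False using berk_pi_eqI by blast
qed

lemma continuous_on_berk_pi_sphere: "continuous_on {\<zeta>. berk_norm \<zeta> = 1} berk_pi"
proof (rule continuous_on_subset[OF continuous_on_berk_pi])
  have "berk_norm (berk_origin :: ('a, 'b) berk_affine) = 0"
    by (simp add: berk_norm_eq_0_iff)
  then show "{\<zeta> :: ('a, 'b) berk_affine. berk_norm \<zeta> = 1} \<subseteq> - {berk_origin}" by auto
qed

text \<open>Outside a given neighbourhood of the Gauss point, all points reduce into
  a finite union of hypersurfaces: each point off the Gauss point has a homogeneous polynomial of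
  Gauss norm 1 that is small at it, smallness is an open condition, and the normalized
  representatives of the points where \<open>\<phi>\<close> is far from its value at the Gauss point form a compact set.\<close>

lemma finite_hypersurface_cover:
  fixes \<phi> :: "('n::finite, 'a::complete_nonarch_field) berk_proj \<Rightarrow> real"
    and \<gamma> :: "('n, 'a) berk_affine"
  assumes \<phi>: "continuous_on UNIV \<phi>" and \<gamma>: "berk_seminorm \<gamma> = gauss_norm" and "\<epsilon> > 0"
  obtains P where "finite P" "\<And>p. p \<in> P \<Longrightarrow> p \<noteq> 0 \<and> (\<exists>d. homogeneous_mpol d p)"
    "\<And>z. \<bar>\<phi> z - \<phi> (berk_pi \<gamma>)\<bar> \<ge> \<epsilon> \<Longrightarrow> \<exists>p\<in>P. p \<in> berk_reduction z"
proof -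
  let ?S = "{\<zeta> :: ('n, 'a) berk_affine. berk_norm \<zeta> = 1}"
  let ?C = "{\<zeta> \<in> ?S. \<epsilon> \<le> \<bar>\<phi> (berk_pi \<zeta>) - \<phi> (berk_pi \<gamma>)\<bar>}"
  let ?F = "{f :: ('n, 'a) mpol. gauss_norm f = 1 \<and> (\<exists>d. homogeneous_mpol d f)}"
  let ?U = "\<lambda>f. {\<zeta> :: ('n, 'a) berk_affine. berk_seminorm \<zeta> f < 1}"
  have cont: "continuous_on ?S (\<lambda>\<zeta>. \<phi> (berk_pi \<zeta>))"
    by (rule continuous_on_compose2[OF \<phi> continuous_on_berk_pi_sphere]) simp
  have "closedin (top_of_set ?S) (?S \<inter> (\<lambda>\<zeta>. \<bar>\<phi> (berk_pi \<zeta>) - \<phi> (berk_pi \<gamma>)\<bar>) -` {\<epsilon>..})"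
    by (intro continuous_closedin_preimage continuous_intros cont closed_atLeast)
  also have "?S \<inter> (\<lambda>\<zeta>. \<bar>\<phi> (berk_pi \<zeta>) - \<phi> (berk_pi \<gamma>)\<bar>) -` {\<epsilon>..} = ?C" by auto
  finally have C: "compact ?C"
    using compact_berk_unit_sphere closedin_compact by blast
  have opn: "open (?U f)" for f
    using open_berk_seminorm_vimage[of "{..<1}" f] by simp
  have cover: "?C \<subseteq> (\<Union>f\<in>?F. ?U f)"
  proof
    fix \<zeta> assume \<zeta>: "\<zeta> \<in> ?C"
    then have "berk_pi \<zeta> \<noteq> berk_pi \<gamma>" using \<open>\<epsilon> > 0\<close> by auto
    with \<zeta> ex_homogeneous_small_if_neq_gauss[OF _ \<gamma>, of \<zeta>] show "\<zeta> \<in> (\<Union>f\<in>?F. ?U f)" by blast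
  qed
  obtain F where F: "F \<subseteq> ?F" "finite F" "?C \<subseteq> (\<Union>f\<in>F. ?U f)"
    by (rule compactE_image[OF C opn cover])
  show ?thesis
  proof (rule that[of "reduce_mpol ` F"])
    show "finite (reduce_mpol ` F)" using F by simp
    show "p \<noteq> 0 \<and> (\<exists>d. homogeneous_mpol d p)" if p: "p \<in> reduce_mpol ` F" for p
    proof -
      obtain f where "f \<in> F" and pf: "p = reduce_mpol f" using p by auto
      then obtain d where "gauss_norm f = 1" "homogeneous_mpol d f" using F(1) by blast
      then show ?thesis
        unfolding pf using reduce_mpol_neq_0 homogeneous_reduce_mpol by blast
    qed
    fix z assume z: "\<bar>\<phi> z - \<phi> (berk_pi \<gamma>)\<bar> \<ge> \<epsilon>"
    obtain \<zeta> where \<zeta>: "berk_pi \<zeta> = z" "berk_norm \<zeta> = 1"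
      "berk_reduction z = homogeneous_part (reduce_mpol ` small_ideal \<zeta>)"
      using berk_reduction_representative by blast
    then have "\<zeta> \<in> ?C" using z by simp
    then obtain f where f: "f \<in> F" "berk_seminorm \<zeta> f < 1" using F(3) by blast
    then obtain d where "gauss_norm f = 1" "homogeneous_mpol d f" using F(1) by blast
    then have "reduce_mpol f \<in> berk_reduction z"
      unfolding \<zeta>(3) using f homogeneous_reduce_mpol
      by (intro homogeneous_in_homogeneous_part[of _ _ d]) (auto simp: small_ideal_iff)
    with f(1) show "\<exists>p\<in>reduce_mpol ` F. p \<in> berk_reduction z" by blast
  qed
qed

lemma berk_reduction_in_Proj: "berk_reduction z \<in> Proj"
  using berk_reduction_representative[of z] homogeneous_part_reduce_small_ideal_in_Proj by metis

lemma bounded_continuous_berk_proj: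
  fixes \<phi> :: "('n::finite, 'a::complete_nonarch_field) berk_proj \<Rightarrow> real"
  assumes \<phi>: "continuous_on UNIV \<phi>"
  obtains B where "\<And>z. \<bar>\<phi> z\<bar> \<le> B"
proof -
  let ?S = "{\<zeta> :: ('n, 'a) berk_affine. berk_norm \<zeta> = 1}"
  have "compact (berk_pi ` ?S)"
    using continuous_on_berk_pi_sphere compact_berk_unit_sphere by (rule compact_continuous_image)
  moreover have "berk_pi ` ?S = UNIV"
  proof (intro equalityI subset_UNIV subsetI)
    fix z :: "('n, 'a) berk_proj"
    obtain \<zeta> where "berk_pi \<zeta> = z" "berk_norm \<zeta> = 1"
      using ex_normalized_representative[of z] by blast
    then show "z \<in> berk_pi ` ?S" by auto
  qed
  ultimately have "compact (range \<phi>)"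
    using \<phi> compact_continuous_image by metis
  then obtain B where "\<forall>x\<in>range \<phi>. norm x \<le> B"
    using compact_imp_bounded bounded_iff by metis
  then show ?thesis by (intro that[of B]) auto
qed

lemma size_filter_mset_le_sum:
  assumes "finite P" "\<And>z. z \<in># M \<Longrightarrow> Q z \<Longrightarrow> \<exists>p\<in>P. R p z"
  shows "size (filter_mset Q M) \<le> (\<Sum>p\<in>P. size (filter_mset (R p) M))"
  using assms(2)
proof (induction M)
  case (add x M)
  then have IH: "size (filter_mset Q M) \<le> (\<Sum>p\<in>P. size (filter_mset (R p) M))" by simp
  have x: "(if Q x then 1 else 0) \<le> (\<Sum>p\<in>P. if R p x then 1 else (0::nat))"
  proof (cases "Q x")
    case True
    then obtain p where "p \<in> P" "R p x" using add.prems[of x] by auto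
    then show ?thesis using member_le_sum[of p P "\<lambda>p. if R p x then 1 else (0::nat)"] assms(1) by simp
  qed simp
  have step: "size (filter_mset S (add_mset x M)) = (if S x then 1 else 0) + size (filter_mset S M)" for S
    by simp
  show ?case unfolding step sum.distrib using x IH by (rule add_mono)
qed simp

lemma sum_mset_deviation_le:
  fixes \<phi> :: "'z \<Rightarrow> real"
  assumes "\<And>z. \<bar>\<phi> z - c\<bar> \<le> B" "0 \<le> \<epsilon>"
  shows "\<bar>(\<Sum>z\<in>#M. \<phi> z) - real (size M) * c\<bar> \<le>
    real (size M) * \<epsilon> + B * real (size (filter_mset (\<lambda>z. \<epsilon> \<le> \<bar>\<phi> z - c\<bar>) M))"
proof (induction M)
  case (add x M)
  have "\<bar>\<phi> x - c\<bar> \<le> \<epsilon> + (if \<epsilon> \<le> \<bar>\<phi> x - c\<bar> then B else 0)"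
    using assms(1)[of x] assms(2) by auto
  then show ?case using add.IH by (auto simp: algebra_simps)
qed simp

theorem theorem9:
  fixes j :: "'k::complete_nonarch_field alg_closure \<Rightarrow> 'c::complete_nonarch_field"
    and N :: nat
    and D :: "'i set"
    and R :: "'i \<Rightarrow> 'i \<Rightarrow> bool"
    and Z :: "'i \<Rightarrow> ('n::finite, 'k) berk_proj multiset"
  assumes "completed_alg_closure j"
    and "N \<ge> 1"
    and "CARD('n) = N + 1"
    and "directed_set D R"
    and "\<And>\<alpha>. \<alpha> \<in> D \<Longrightarrow> Z \<alpha> \<noteq> {#}"
    and "weakly_generic (net_filter D R) (\<lambda>\<alpha>. image_mset berk_reduction (Z \<alpha>))"
  shows "equidistributed (return borel (gauss_point j)) (net_filter D R) Z"
  unfolding equidistributed_def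
proof (intro allI impI)
  fix \<phi> :: "('n, 'k) berk_proj \<Rightarrow> real"
  assume \<phi>: "continuous_on UNIV \<phi>"
  define c where "c = \<phi> (gauss_point j)"
  let ?F = "net_filter D R"
  have "\<phi> \<in> borel_measurable borel"
    using \<phi> by (rule borel_measurable_continuous_onI)
  then have int: "(\<integral>z. \<phi> z \<partial>return borel (gauss_point j)) = c"
    unfolding c_def by (intro integral_return) auto
  obtain B where B: "\<And>z. \<bar>\<phi> z\<bar> \<le> B" by (rule bounded_continuous_berk_proj[OF \<phi>]) blast
  have dev: "\<bar>\<phi> z - c\<bar> \<le> 2 * B" for z
    using B[of z] B[of "gauss_point j"] by (simp add: c_def)
  have nonempty: "\<forall>\<^sub>F \<alpha> in ?F. Z \<alpha> \<noteq> {#}"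
    unfolding eventually_net_filter[OF assms(4)] using assms(4,5) by (auto simp: directed_set_def)
  have "((\<lambda>\<alpha>. (\<Sum>z\<in>#Z \<alpha>. \<phi> z) / real (size (Z \<alpha>))) \<longlongrightarrow> c) ?F"
  proof (rule tendstoI)
    fix e :: real assume "e > 0"
    \<comment> \<open>Half of the tolerance is for points at which \<open>\<phi>\<close> is close to its value at the Gauss point, half for
      the few others.\<close>
    define \<epsilon> where "\<epsilon> = e / 2"
    have \<epsilon>: "\<epsilon> > 0" using \<open>e > 0\<close> by (simp add: \<epsilon>_def)
    obtain P where P: "finite P" "\<And>p. p \<in> P \<Longrightarrow> p \<noteq> 0 \<and> (\<exists>d. homogeneous_mpol d p)"
      "\<And>z. \<bar>\<phi> z - c\<bar> \<ge> \<epsilon> \<Longrightarrow> \<exists>p\<in>P. p \<in> berk_reduction z"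
      by (rule finite_hypersurface_cover[OF \<phi> berk_seminorm_gauss_affine[OF assms(1)] \<epsilon>,
            folded gauss_point_def c_def]) blast
    let ?frac = "\<lambda>p \<alpha>. real (size (filter_mset (\<lambda>z. p \<in> berk_reduction z) (Z \<alpha>))) / real (size (Z \<alpha>))"
    have "(?frac p \<longlongrightarrow> 0) ?F" if p: "p \<in> P" for p
    proof -
      let ?W = "{q \<in> Proj. p \<in> q}"
      have "Proj_closed ?W" using P(2)[OF p] Proj_closed_hypersurface by blast
      moreover have "?W \<noteq> Proj"
      proof
        assume "?W = Proj"
        then have "{0} \<in> ?W" using zero_ideal_in_Proj by simp
        with P(2)[OF p] show False by simp
      qed
      ultimately have "((\<lambda>\<alpha>. real (size (filter_mset (\<lambda>z. z \<in> ?W) (image_mset berk_reduction (Z \<alpha>)))) /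
          real (size (image_mset berk_reduction (Z \<alpha>)))) \<longlongrightarrow> 0) ?F"
        using assms(6) unfolding weakly_generic_def by blast
      then show ?thesis
        by (simp add: filter_mset_image_mset berk_reduction_in_Proj)
    qed
    then have "((\<lambda>\<alpha>. 2 * B * (\<Sum>p\<in>P. ?frac p \<alpha>)) \<longlongrightarrow> 2 * B * (\<Sum>p\<in>P. 0)) ?F"
      by (intro tendsto_intros)
    then have "\<forall>\<^sub>F \<alpha> in ?F. 2 * B * (\<Sum>p\<in>P. ?frac p \<alpha>) < \<epsilon>"
      using \<epsilon> by (intro order_tendstoD(2)) auto
    with nonempty show "\<forall>\<^sub>F \<alpha> in ?F. dist ((\<Sum>z\<in>#Z \<alpha>. \<phi> z) / real (size (Z \<alpha>))) c < e"
    proof eventually_elim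
      case (elim \<alpha>)
      let ?n = "real (size (Z \<alpha>))"
      let ?bad = "real (size (filter_mset (\<lambda>z. \<epsilon> \<le> \<bar>\<phi> z - c\<bar>) (Z \<alpha>)))"
      have n: "?n > 0" using elim(1) by (simp add: nonempty_has_size)
      have B0: "0 \<le> 2 * B" using B[of "gauss_point j"] by (simp add: order_trans[OF abs_ge_zero])
      have "?bad \<le> real (\<Sum>p\<in>P. size (filter_mset (\<lambda>z. p \<in> berk_reduction z) (Z \<alpha>)))"
        using size_filter_mset_le_sum[of P "Z \<alpha>" "\<lambda>z. \<epsilon> \<le> \<bar>\<phi> z - c\<bar>" "\<lambda>p z. p \<in> berk_reduction z"] P(1,3)
        by (simp only: of_nat_le_iff)
      then have "?bad / ?n \<le> (\<Sum>p\<in>P. ?frac p \<alpha>)"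
        using n by (simp add: divide_right_mono flip: sum_divide_distrib)
      then have "2 * B * (?bad / ?n) \<le> 2 * B * (\<Sum>p\<in>P. ?frac p \<alpha>)"
        using B0 by (rule mult_left_mono)
      also have "\<dots> < \<epsilon>" by (rule elim(2))
      finally have bad: "2 * B * ?bad < \<epsilon> * ?n" using n by (simp add: field_simps)
      have "\<bar>(\<Sum>z\<in>#Z \<alpha>. \<phi> z) - ?n * c\<bar> \<le> ?n * \<epsilon> + 2 * B * ?bad"
        using \<epsilon> by (intro sum_mset_deviation_le dev) simp
      also have "\<dots> < e * ?n" using bad by (simp add: \<epsilon>_def field_simps)
      finally have "\<bar>(\<Sum>z\<in>#Z \<alpha>. \<phi> z) - ?n * c\<bar> / ?n < e" using n by (simp add: field_simps)
      moreover have "(\<Sum>z\<in>#Z \<alpha>. \<phi> z) / ?n - c = ((\<Sum>z\<in>#Z \<alpha>. \<phi> z) - ?n * c) / ?n"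
        using elim(1) by (simp add: diff_divide_distrib)
      ultimately show ?case using n by (simp add: dist_real_def abs_divide)
    qed
  qed
  then show "((\<lambda>\<alpha>. (\<Sum>z\<in>#Z \<alpha>. \<phi> z) / real (size (Z \<alpha>))) \<longlongrightarrow>
      (\<integral>z. \<phi> z \<partial>return borel (gauss_point j))) ?F"
    unfolding int .
qed

end
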